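(* Let $(D,\mu)$ be a probability space, let $V_m\subset L_2(D,\mu)\cap B(D)$ be a linear space with $\dim(V_m)=m\ge 1$, and let $2\le p\le\infty$. For all integers $n>m$, there are points $x_1,\dots,x_{2n}\in D$ such that, for all $f\in B(D)$ (measurable if $p<\infty$) and any noise $e=(e_1,\dots,e_{2n})\in\mathbb C^{2n}$, the plain least squares approximation $$\tilde f:=\operatorname*{arg\,min}_{g\in V_m}\sum_{i=1}^{2n}|y_i-g(x_i)|^2,\qquad y_i=f(x_i)+e_i,$$ is uniquely defined and satisfies $$\|f-\tilde f\|_p\ \le\ \Big(1+\sqrt2\cdot\frac{m^{1/2-1/p}}{1-\sqrt{m/n}}\Big)\Big(\min_{g\in V_m}\|f-g\|_\infty+\|e\|_\infty\Big).$$ Moreover, for $p\in\{2,\infty\}$, one can use $n$ points $x_1,\dots,x_n$ instead of $2n$ points (with data $y_1,\dots,y_n$ and noise $e\in\mathbb C^n$), the factor $\sqrt2$ can be removed, and it suffices to assume $V_m\subset L_2(D,\mu)$ if $p=2$, respectively $V_m\subset B(D)$ if $p=\infty$, instead of $V_m\subset L_2(D,\mu)\cap B(D)$.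
   Context: Functions are complex-valued; $L_2(D,\mu)$ consists of functions, not equivalence classes. $B(D)$ is the space of bounded functions on $D$. For $p<\infty$, $\|\cdot\|_p$ is the norm of $L_p(D,\mu)$; for functions, $\|f\|_\infty=\sup_{x\in D}|f(x)|$ is the sup-norm; for vectors, $\|e\|_\infty=\max_i|e_i|$; and $1/\infty=0$. *)

theory Defs
  imports "HOL-Probability.Probability" "HOL-Library.Function_Algebras"
begin

text \<open>
  Complex-valued functions on a set \<open>D\<close> are represented by total functions that vanish outside
  \<open>D\<close>, so that equality of representatives is equality on \<open>D\<close>, and vector space notions for
  functions on \<open>D\<close> are those of the pointwise complex vector space \<open>'a \<Rightarrow> complex\<close>.
\<close>

global_interpretation cfun: vector_space "\<lambda>(c::complex) (f::'a \<Rightarrow> complex) x. c * f x"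
  by unfold_locales (auto simp: fun_eq_iff algebra_simps)

definition bounded_funs :: "'a set \<Rightarrow> ('a \<Rightarrow> complex) set" where
  "bounded_funs D = {f. (\<forall>x. x \<notin> D \<longrightarrow> f x = 0) \<and> bounded (f ` D)}"

text \<open>Functions, not equivalence classes.\<close>

definition L2_funs :: "'a measure \<Rightarrow> ('a \<Rightarrow> complex) set" where
  "L2_funs M = {f. (\<forall>x. x \<notin> space M \<longrightarrow> f x = 0) \<and> f \<in> borel_measurable M \<and>
                   integrable M (\<lambda>x. (cmod (f x))\<^sup>2)}"

text \<open>For \<open>p = \<infinity>\<close> this is the supremum over all points, not the essential supremum.\<close>

definition fun_norm :: "'a measure \<Rightarrow> ennreal \<Rightarrow> ('a \<Rightarrow> complex) \<Rightarrow> ennreal" where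
  "fun_norm M p f =
     (if p = \<infinity> then (SUP x\<in>space M. ennreal (cmod (f x)))
      else let I = (\<integral>\<^sup>+x. ennreal (cmod (f x) powr enn2real p) \<partial>M)
           in if I = \<infinity> then \<infinity> else ennreal (enn2real I powr (1 / enn2real p)))"

definition noise_norm :: "nat \<Rightarrow> (nat \<Rightarrow> complex) \<Rightarrow> real" where
  "noise_norm N e = Max ((\<lambda>i. cmod (e i)) ` {1..N})"

definition lsq_residual :: "nat \<Rightarrow> (nat \<Rightarrow> 'a) \<Rightarrow> (nat \<Rightarrow> complex) \<Rightarrow> ('a \<Rightarrow> complex) \<Rightarrow> real" where
  "lsq_residual N x y g = (\<Sum>i=1..N. (cmod (y i - g (x i)))\<^sup>2)"

definition lsq :: "('a \<Rightarrow> complex) set \<Rightarrow> nat \<Rightarrow> (nat \<Rightarrow> 'a) \<Rightarrow> (nat \<Rightarrow> complex) \<Rightarrow> 'a \<Rightarrow> complex" where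
  "lsq V N x y = arg_min (lsq_residual N x y) (\<lambda>g. g \<in> V)"

text \<open>
  The points \<open>x 1, \<dots>, x N\<close> admit the least squares error bound with constant \<open>C\<close>. The function
  \<open>g\<close> below attains the minimal sup-norm distance of \<open>f\<close> to \<open>V\<close>; that the minimum exists is part
  of the claim.
\<close>

definition lsq_error_bound ::
  "'a measure \<Rightarrow> ('a \<Rightarrow> complex) set \<Rightarrow> ennreal \<Rightarrow> nat \<Rightarrow> (nat \<Rightarrow> 'a) \<Rightarrow> real \<Rightarrow> bool" where
  "lsq_error_bound M V p N x C \<longleftrightarrow>
     (\<forall>f \<in> bounded_funs (space M). (p < \<infinity> \<longrightarrow> f \<in> borel_measurable M) \<longrightarrow>
       (\<forall>e :: nat \<Rightarrow> complex.
          let y = (\<lambda>i. f (x i) + e i) in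
          (\<exists>!g. is_arg_min (lsq_residual N x y) (\<lambda>h. h \<in> V) g) \<and>
          (\<exists>g. is_arg_min (\<lambda>h. fun_norm M \<infinity> (f - h)) (\<lambda>h. h \<in> V) g \<and>
               fun_norm M p (f - lsq V N x y)
                 \<le> ennreal C * (fun_norm M \<infinity> (f - g) + ennreal (noise_norm N e)))))"

end

theory Submission
  imports Defs
begin

text \<open>
  Write \<open>S g\<close> for the sum of \<open>(cmod (g (x i)))\<^sup>2\<close> over the sample points. Least squares is an orthogonal
  projection for the form that \<open>S\<close> comes from, so if \<open>g\<close> is a best uniform approximation of \<open>f\<close>, with
  error \<open>a\<close>, and if the noise is at most \<open>\<nu>\<close>, then \<open>S\<close> of \<open>h = g - lsq\<close> is at most the residual of \<open>g\<close>, hence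
  at most \<open>N * (a + \<nu>)\<^sup>2\<close>. The theorem therefore reduces to the construction of points for which
  \<open>S\<close> controls the \<open>L2\<close> norm and the sup norm on \<open>V\<close>, with the constants
  \<open>(sqrt n - sqrt m)\<^sup>2 * \<integral>(cmod h)\<^sup>2 \<le> S h\<close> (lemma \<open>L2_sampling\<close>) and
  \<open>(sqrt n - sqrt m)\<^sup>2 * (cmod (h y))\<^sup>2 \<le> m * S h\<close> (lemma \<open>uniform_sampling\<close>). For general \<open>p\<close> both
  families of \<open>n\<close> points are joined, which costs the factor \<open>sqrt 2\<close>, and the two bounds are
  interpolated: \<open>(cmod h) powr p\<close> is at most \<open>(sup norm) powr (p - 2) * (cmod h)\<^sup>2\<close>.

  Both families come from one greedy selection, the lower half of the argument of Batson, Spielman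
  and Srivastava for spectral sparsification. Let \<open>G\<close> be an inner product on \<open>V\<close>. Points are added one
  at a time while a barrier \<open>l\<close> moves up by \<open>\<delta>\<close> per point, in such a way that the form \<open>S - l * G\<close>
  stays positive definite; the quantity that is kept bounded is the trace, relative to \<open>G\<close>, of the inverse of
  this form (lemma \<open>barrier_step\<close>). As only a lower bound is wanted, every point can be used with weight one.
  The selection uses one property of \<open>G\<close>: a weighted sum of squares
  \<open>(cmod (h i x))\<^sup>2\<close> of functions in \<open>V\<close> is, at some point \<open>x\<close>, almost as large as the same sum of the \<open>G (h i) (h i)\<close>;
  this is the predicate \<open>isotropic\<close> below. The selection has a little room: its constant strictly
  exceeds \<open>(sqrt n - sqrt m)\<^sup>2\<close> by an amount that depends only on \<open>m\<close> and \<open>n\<close>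
  (lemma \<open>sampling_constant_exists\<close>).

  For the \<open>L2\<close> bound, the inner product of \<open>L2\<close> itself would be isotropic by averaging, but it may vanish on
  nonzero functions of \<open>V\<close> that are zero almost everywhere. A small multiple of a discrete form is
  mixed in, which repairs this, and the room in the selection pays for it. The points that it
  yields also determine the functions in \<open>V\<close>, so the least squares approximation is unique.

  For the sup norm, the inner product is the one whose unit ball is extremal (the Kiefer-Wolfowitz
  design, in its dual formulation as an ellipsoid of John and Loewner): among the bases \<open>b\<close> of \<open>V\<close> with
  \<open>(\<Sum>i<m. (cmod (b i x))\<^sup>2) \<le> m\<close> for all \<open>x\<close>, one of maximal determinant is declared to be orthonormal. The
  constraint gives the bound by \<open>m\<close>, and maximality gives isotropy (theorem \<open>uniform_design\<close>). Restricting to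
  bases that are triangular with respect to a fixed one turns the determinant into a product of
  diagonal entries. As \<open>V\<close> is finite-dimensional, such bases form a compact set in the topology
  of pointwise convergence, for an arbitrary domain.
\<close>

section \<open>Positive definite forms on finite-dimensional function spaces\<close>

text \<open>
  The scaling of functions is a constant of its own, rather than an abstraction, to keep the
  simplifier from rewriting inside it.
\<close>
definition smult :: "complex \<Rightarrow> ('a \<Rightarrow> complex) \<Rightarrow> 'a \<Rightarrow> complex" where
  "smult c f = (\<lambda>x. c * f x)"

lemma smult_apply [simp]: "smult c f x = c * f x"
  by (simp add: smult_def)

lemma smult_0: "smult 0 f = 0"
  by (simp add: fun_eq_iff)

lemma subspace_smult: "cfun.subspace V \<Longrightarrow> f \<in> V \<Longrightarrow> smult c f \<in> V"
  unfolding smult_def by (rule cfun.subspace_scale)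

definition lincomb :: "nat \<Rightarrow> (nat \<Rightarrow> complex) \<Rightarrow> (nat \<Rightarrow> 'a \<Rightarrow> complex) \<Rightarrow> 'a \<Rightarrow> complex" where
  "lincomb d c u = (\<lambda>x. \<Sum>i<d. c i * u i x)"

lemma lincomb_0: "lincomb 0 c u = 0"
  by (simp add: lincomb_def fun_eq_iff)

lemma lincomb_Suc: "lincomb (Suc d) c u = lincomb d c u + smult (c d) (u d)"
  by (simp add: lincomb_def fun_eq_iff)

lemma lincomb_in_subspace:
  assumes "cfun.subspace V" "\<And>i. i < d \<Longrightarrow> u i \<in> V"
  shows "lincomb d c u \<in> V"
  using assms(2)
proof (induction d)
  case 0
  show ?case unfolding lincomb_0 by (rule cfun.subspace_0[OF assms(1)])
next
  case (Suc d)
  then show ?case unfolding lincomb_Suc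
    by (intro cfun.subspace_add[OF assms(1)] subspace_smult[OF assms(1)]) auto
qed

text \<open>
  An inner product on \<open>V\<close>, linear in the first argument. The axioms are restricted to \<open>V\<close> because forms
  such as the integral of \<open>f * cnj g\<close> are inner products only on suitable subspaces.
\<close>
locale pd_form =
  fixes V :: "('a \<Rightarrow> complex) set" and G :: "('a \<Rightarrow> complex) \<Rightarrow> ('a \<Rightarrow> complex) \<Rightarrow> complex"
  assumes sub: "cfun.subspace V"
    and add: "f \<in> V \<Longrightarrow> g \<in> V \<Longrightarrow> h \<in> V \<Longrightarrow> G (f + g) h = G f h + G g h"
    and scale: "f \<in> V \<Longrightarrow> h \<in> V \<Longrightarrow> G (smult c f) h = c * G f h"
    and herm: "f \<in> V \<Longrightarrow> g \<in> V \<Longrightarrow> G f g = cnj (G g f)"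
    and pos: "f \<in> V \<Longrightarrow> f \<noteq> 0 \<Longrightarrow> 0 < Re (G f f)"
begin

lemmas V_0 = cfun.subspace_0[OF sub]
lemmas V_add = cfun.subspace_add[OF sub]
lemmas V_diff = cfun.subspace_diff[OF sub]
lemmas V_scale = subspace_smult[OF sub]
lemmas V_lincomb = lincomb_in_subspace[OF sub]
lemmas V_intros = V_0 V_add V_diff V_scale V_lincomb

lemma zero_left: "h \<in> V \<Longrightarrow> G 0 h = 0"
  using scale[of 0 h 0] V_0 by (simp add: smult_0)

lemma zero_right: "h \<in> V \<Longrightarrow> G h 0 = 0"
  using zero_left herm[of h 0] V_0 by simp

lemma nonneg: "f \<in> V \<Longrightarrow> 0 \<le> Re (G f f)"
  using pos[of f] zero_left[of 0] V_0 by (cases "f = 0") (auto simp: less_imp_le)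

lemma eq_0I: "f \<in> V \<Longrightarrow> Re (G f f) \<le> 0 \<Longrightarrow> f = 0"
  using pos[of f] by force

lemma Im_diag: "f \<in> V \<Longrightarrow> Im (G f f) = 0"
  using herm[of f f] by (metis Reals_cnj_iff complex_is_Real_iff)

lemma diag_eq: "f \<in> V \<Longrightarrow> G f f = of_real (Re (G f f))"
  using Im_diag by (simp add: complex_eq_iff)

lemma add_right: "f \<in> V \<Longrightarrow> g \<in> V \<Longrightarrow> h \<in> V \<Longrightarrow> G h (f + g) = G h f + G h g"
  using herm[of h "f+g"] herm[of h f] herm[of h g] add[of f g h] V_add[of f g] by simp

lemma scale_right: "f \<in> V \<Longrightarrow> h \<in> V \<Longrightarrow> G h (smult c f) = cnj c * G h f"
  using herm[of h "smult c f"] herm[of h f] scale[of f h c] V_scale[of f c] by simp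

lemma diff_eq_add: "f - g = f + smult (-1) (g :: 'a \<Rightarrow> complex)"
  by (simp add: fun_eq_iff)

lemma diff_left: "f \<in> V \<Longrightarrow> g \<in> V \<Longrightarrow> h \<in> V \<Longrightarrow> G (f - g) h = G f h - G g h"
  unfolding diff_eq_add using add scale V_scale[of g "-1"] by simp

lemma diff_right: "f \<in> V \<Longrightarrow> g \<in> V \<Longrightarrow> h \<in> V \<Longrightarrow> G h (f - g) = G h f - G h g"
  unfolding diff_eq_add using add_right scale_right V_scale[of g "-1"] by simp

lemma lincomb_left:
  "(\<And>i. i < d \<Longrightarrow> u i \<in> V) \<Longrightarrow> h \<in> V \<Longrightarrow> G (lincomb d c u) h = (\<Sum>i<d. c i * G (u i) h)"
proof (induction d)
  case 0
  show ?case unfolding lincomb_0 using zero_left[OF \<open>h \<in> V\<close>] by (simp add: zero_fun_def)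
next
  case (Suc d)
  then show ?case unfolding lincomb_Suc
    by (subst add) (auto intro: V_intros simp: scale)
qed

lemma lincomb_right:
  "(\<And>i. i < d \<Longrightarrow> u i \<in> V) \<Longrightarrow> h \<in> V \<Longrightarrow> G h (lincomb d c u) = (\<Sum>i<d. cnj (c i) * G h (u i))"
proof (induction d)
  case 0
  show ?case unfolding lincomb_0 using zero_right[OF \<open>h \<in> V\<close>] by (simp add: zero_fun_def)
next
  case (Suc d)
  then show ?case unfolding lincomb_Suc
    by (subst add_right) (auto intro: V_intros simp: scale_right)
qed

lemma nondegenerate:
  assumes "f \<in> V" "g \<in> V" "\<And>h. h \<in> V \<Longrightarrow> G f h = G g h"
  shows "f = g"
proof -
  have "G (f - g) (f - g) = 0"
    using assms(3)[of "f - g"] diff_left[of f g "f - g"] assms V_diff by simp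
  then have "f - g = 0" using eq_0I[of "f - g"] V_diff assms by simp
  then show ?thesis by simp
qed

text \<open>
  The square norm of \<open>G g g * f - G f g * g\<close> is nonnegative. Multiplying by \<open>G g g\<close> instead of dividing
  by it keeps the computation polynomial.
\<close>
lemma Cauchy_Schwarz:
  assumes f: "f \<in> V" and g: "g \<in> V"
  shows "(cmod (G f g))\<^sup>2 \<le> Re (G f f) * Re (G g g)"
proof (cases "g = 0")
  case True
  then show ?thesis using zero_left zero_right f g by simp
next
  case False
  define a where "a = Re (G g g)"
  define z where "z = G f g"
  have a: "a > 0" using pos[OF g False] by (simp add: a_def)
  have gg: "G g g = of_real a" using diag_eq[OF g] by (simp add: a_def)
  have gf: "G g f = cnj z" using herm[OF g f] by (simp add: z_def)
  define h where "h = smult (of_real a) f - smult z g"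
  have "0 \<le> Re (G h h)" unfolding h_def by (intro nonneg V_intros f g)
  also have "G h h = of_real a * (of_real a * G f f) - of_real a * (cnj z * z)
        - z * (of_real a * cnj z) + z * (cnj z * of_real a)"
    unfolding h_def using f g
    by (simp add: diff_left diff_right scale scale_right V_intros gg gf z_def[symmetric] algebra_simps)
  also have "\<dots> = of_real a * (of_real a * G f f) - of_real (a * (cmod z)\<^sup>2)"
    unfolding of_real_mult complex_norm_square by (simp add: algebra_simps)
  finally have "0 \<le> a * (a * Re (G f f) - (cmod z)\<^sup>2)" by (simp add: algebra_simps)
  with a have "0 \<le> a * Re (G f f) - (cmod z)\<^sup>2" by (simp add: zero_le_mult_iff)
  then show ?thesis by (simp add: z_def a_def mult.commute)
qed

end

definition orthonormal_basis ::
  "('a \<Rightarrow> complex) set \<Rightarrow> (('a \<Rightarrow> complex) \<Rightarrow> ('a \<Rightarrow> complex) \<Rightarrow> complex) \<Rightarrow> nat \<Rightarrow> (nat \<Rightarrow> 'a \<Rightarrow> complex) \<Rightarrow> bool"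
  where "orthonormal_basis V G d u \<longleftrightarrow>
    (\<forall>i<d. u i \<in> V) \<and> (\<forall>i<d. \<forall>j<d. G (u i) (u j) = (if i = j then 1 else 0)) \<and>
    (\<forall>g\<in>V. g = lincomb d (\<lambda>i. G g (u i)) u)"

context pd_form
begin

text \<open>
  Gram-Schmidt, one basis element at a time: a new element \<open>a\<close> is replaced by its normalized component
  orthogonal to the span of the previous ones.
\<close>
lemma Gram_Schmidt_span:
  assumes "finite B" "cfun.independent B" "B \<subseteq> V"
  shows "\<exists>u. (\<forall>i<card B. u i \<in> cfun.span B) \<and>
     (\<forall>i<card B. \<forall>j<card B. G (u i) (u j) = (if i = j then 1 else 0)) \<and>
     (\<forall>g\<in>cfun.span B. g = lincomb (card B) (\<lambda>i. G g (u i)) u)"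
  using assms
proof (induction B rule: finite_induct)
  case empty
  show ?case by (auto simp: lincomb_0)
next
  case (insert a B)
  have ind: "cfun.independent B" and a: "a \<notin> cfun.span B" and aV: "a \<in> V" and BV: "B \<subseteq> V"
    using insert.prems insert.hyps by (auto simp: cfun.independent_insert)
  obtain u where u: "\<And>i. i < card B \<Longrightarrow> u i \<in> cfun.span B"
    "\<And>i j. i < card B \<Longrightarrow> j < card B \<Longrightarrow> G (u i) (u j) = (if i = j then 1 else 0)"
    "\<And>g. g \<in> cfun.span B \<Longrightarrow> g = lincomb (card B) (\<lambda>i. G g (u i)) u"
    using insert.IH[OF ind BV] by blast
  define d where "d = card B"
  have spV: "cfun.span B \<subseteq> V" using BV sub by (rule cfun.span_minimal)
  have uV: "u i \<in> V" if "i < d" for i using u(1)[of i] that spV by (auto simp: d_def)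
  define p where "p = lincomb d (\<lambda>i. G a (u i)) u"
  have pB: "p \<in> cfun.span B" unfolding p_def
    using u(1) by (intro lincomb_in_subspace cfun.subspace_span) (auto simp: d_def)
  define q where "q = a - p"
  have qV: "q \<in> V" using pB spV aV by (auto simp: q_def intro: V_intros)
  have "q \<noteq> 0" using a pB by (auto simp: q_def)
  define t where "t = Re (G q q)"
  have t: "t > 0" using pos[OF qV \<open>q \<noteq> 0\<close>] by (simp add: t_def)
  have pu: "G p (u j) = G a (u j)" if "j < d" for j
  proof -
    have "G p (u j) = (\<Sum>i<d. G a (u i) * G (u i) (u j))"
      unfolding p_def by (rule lincomb_left) (use uV that in auto)
    also have "\<dots> = (\<Sum>i<d. if i = j then G a (u j) else 0)"
      by (intro sum.cong refl) (use u(2) that in \<open>auto simp: d_def\<close>)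
    finally show ?thesis using that by simp
  qed
  have qu: "G q (u j) = 0" if "j < d" for j
    unfolding q_def using pu[OF that] diff_left[of a p "u j"] aV pB spV uV[OF that] by auto
  have qB: "G q g = 0" if "g \<in> cfun.span B" for g
  proof -
    have "G q g = G q (lincomb d (\<lambda>i. G g (u i)) u)"
      using u(3)[OF that] by (simp add: d_def)
    also have "\<dots> = (\<Sum>i<d. cnj (G g (u i)) * G q (u i))"
      by (rule lincomb_right) (use uV qV in auto)
    finally show ?thesis using qu by simp
  qed
  define w where "w = smult (of_real (1 / sqrt t)) q"
  have wV: "w \<in> V" unfolding w_def by (intro V_intros qV)
  have wB: "G w g = 0" if "g \<in> cfun.span B" for g
    unfolding w_def using scale[OF qV, of g] qB[OF that] that spV by auto
  have ww: "G w w = 1"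
  proof -
    have "G w w = of_real (1 / sqrt t) * (of_real (1 / sqrt t) * of_real t)"
      unfolding w_def using qV diag_eq[OF qV] by (simp add: scale scale_right V_intros t_def)
    also have "\<dots> = of_real ((1 / sqrt t) * (1 / sqrt t) * t)" by (simp only: of_real_mult mult.assoc)
    also have "(1 / sqrt t) * (1 / sqrt t) * t = 1"
      using t by simp
    finally show ?thesis by simp
  qed
  define u' where "u' = u(d := w)"
  have card: "card (insert a B) = Suc d" using insert.hyps by (simp add: d_def)
  have sub': "cfun.span B \<subseteq> cfun.span (insert a B)" by (rule cfun.span_mono) auto
  have asp: "a \<in> cfun.span (insert a B)" by (rule cfun.span_base) auto
  have qsp: "q \<in> cfun.span (insert a B)" unfolding q_def
    using pB sub' asp by (intro cfun.span_diff) auto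
  have wsp: "w \<in> cfun.span (insert a B)" unfolding w_def using qsp
    by (intro subspace_smult cfun.subspace_span)
  have 1: "u' i \<in> cfun.span (insert a B)" if "i < Suc d" for i
    using that u(1)[of i] sub' wsp by (auto simp: u'_def d_def less_Suc_eq)
  have uw: "G (u i) w = 0" if "i < d" for i
    using herm[OF uV[OF that] wV] wB[OF u(1)] that by (simp add: d_def)
  have 2: "G (u' i) (u' j) = (if i = j then 1 else 0)" if "i < Suc d" "j < Suc d" for i j
    using that u(1)[of j] u(2)[of i j] ww wB uw by (auto simp: u'_def d_def less_Suc_eq)
  have 3: "g = lincomb (Suc d) (\<lambda>i. G g (u' i)) u'" if g: "g \<in> cfun.span (insert a B)" for g
  proof -
    from g obtain k where k: "g - smult k a \<in> cfun.span B"
      using cfun.span_breakdown_eq[of g a B] by (auto simp: smult_def)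
    define h where "h = g - smult k a + smult k p"
    have h: "h \<in> cfun.span B" unfolding h_def using k pB
      by (intro cfun.span_add subspace_smult cfun.subspace_span) auto
    have gh: "g = h + smult (k * of_real (sqrt t)) w"
    proof -
      have "(of_real (sqrt t) :: complex) * of_real (1 / sqrt t) = 1"
        using t by (simp add: of_real_divide)
      then have "k * of_real (sqrt t) * (of_real (1 / sqrt t) * y) = k * y" for y
        by (metis mult.assoc mult.left_neutral)
      then show ?thesis
        using t by (simp add: fun_eq_iff h_def w_def q_def algebra_simps)
    qed
    have hV: "h \<in> V" using h spV by auto
    have gw: "G g w = k * of_real (sqrt t)"
    proof -
      have "G h w = 0" using herm[OF hV wV] wB[OF h] by simp
      then show ?thesis
        using gh add[of h "smult (k * of_real (sqrt t)) w" w] hV wV ww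
          scale[OF wV wV] V_scale[OF wV] by simp
    qed
    have gu: "G g (u i) = G h (u i)" if "i < d" for i
      using gh add[of h "smult (k * of_real (sqrt t)) w" "u i"] hV wV uV[OF that]
        wB[OF u(1)] that scale[OF wV uV[OF that]] V_scale[OF wV] by (simp add: d_def)
    have "lincomb (Suc d) (\<lambda>i. G g (u' i)) u' = lincomb d (\<lambda>i. G h (u i)) u + smult (G g w) w"
      unfolding lincomb_Suc using gu by (simp add: lincomb_def u'_def fun_eq_iff)
    also have "lincomb d (\<lambda>i. G h (u i)) u = h" using u(3)[OF h] by (simp add: d_def)
    finally show ?thesis using gh unfolding gw by (rule trans[rotated, OF sym])
  qed
  show ?case unfolding card using 1 2 3 by blast
qed

lemma orthonormal_basis_exists:
  assumes "cfun.dim V = d" "d \<ge> 1"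
  obtains u where "orthonormal_basis V G d u"
proof -
  obtain B where B: "B \<subseteq> V" "cfun.independent B" "V \<subseteq> cfun.span B" "card B = d"
    using cfun.basis_exists[of V] assms by metis
  have fin: "finite B" using B(4) assms by (intro card_ge_0_finite) simp
  have span: "cfun.span B = V" using B cfun.span_minimal[OF B(1) sub] by auto
  show ?thesis
    using Gram_Schmidt_span[OF fin B(2,1)] that unfolding span B(4) orthonormal_basis_def by blast
qed

lemma Parseval:
  assumes u: "orthonormal_basis V G d u" and f: "f \<in> V" and g: "g \<in> V"
  shows "G f g = (\<Sum>i<d. G f (u i) * cnj (G g (u i)))"
proof -
  have uV: "\<And>i. i < d \<Longrightarrow> u i \<in> V" using u by (auto simp: orthonormal_basis_def)
  have "G f g = G f (lincomb d (\<lambda>i. G g (u i)) u)"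
    using u g by (simp add: orthonormal_basis_def)
  also have "\<dots> = (\<Sum>i<d. cnj (G g (u i)) * G f (u i))"
    by (rule lincomb_right) (use uV f in auto)
  finally show ?thesis by (simp add: mult.commute)
qed

lemma Parseval_norm:
  assumes u: "orthonormal_basis V G d u" and f: "f \<in> V"
  shows "Re (G f f) = (\<Sum>i<d. (cmod (G f (u i)))\<^sup>2)"
  unfolding Parseval[OF u f f] complex_norm_square[symmetric] by simp

end

section \<open>Inverse forms and the barrier shift\<close>

text \<open>
  The operator \<open>R\<close> is the inverse of the form \<open>M\<close>, seen through \<open>G\<close>: if \<open>M\<close> and \<open>G\<close> have the matrices
  \<open>A\<close> and \<open>I\<close> in some basis, then \<open>R\<close> has the matrix \<open>A\<close> inverse. Describing the inverse by
  \<open>M (R f) g = G f g\<close> makes all identities between resolvents consequences of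
  nondegeneracy, without matrices.
\<close>
locale represented_form = G: pd_form V G + M: pd_form V M
  for V :: "('a \<Rightarrow> complex) set" and G M +
  fixes R :: "('a \<Rightarrow> complex) \<Rightarrow> 'a \<Rightarrow> complex"
  assumes R_in: "f \<in> V \<Longrightarrow> R f \<in> V"
    and R_rep: "f \<in> V \<Longrightarrow> g \<in> V \<Longrightarrow> M (R f) g = G f g"
begin

lemma R_eqI: "f \<in> V \<Longrightarrow> h \<in> V \<Longrightarrow> (\<And>g. g \<in> V \<Longrightarrow> M h g = G f g) \<Longrightarrow> R f = h"
  by (rule M.nondegenerate) (auto simp: R_in R_rep)

lemma R_diff_smult:
  assumes "f \<in> V" "g \<in> V"
  shows "R (f - smult c g) = R f - smult c (R g)"
proof (rule R_eqI)
  show "M (R f - smult c (R g)) h = G (f - smult c g) h" if "h \<in> V" for h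
    using assms that by (simp add: M.diff_left M.scale G.diff_left G.scale R_in R_rep
        M.V_scale)
qed (use assms R_in in \<open>auto intro: M.V_intros\<close>)

lemma R_selfadjoint: "f \<in> V \<Longrightarrow> g \<in> V \<Longrightarrow> G (R f) g = G f (R g)"
  using G.herm[of "R f" g] R_rep[of g "R f"] M.herm[of "R f" "R g"] R_rep[of f "R g"] R_in
  by simp

lemma R_energy: "f \<in> V \<Longrightarrow> G (R f) f = M (R f) (R f)"
  using R_selfadjoint[of f f] R_rep[of f "R f"] R_in by simp

lemma R_nonneg: "f \<in> V \<Longrightarrow> 0 \<le> Re (G (R f) f)"
  using R_energy M.nonneg R_in by simp

lemma R_pos:
  assumes "f \<in> V" "f \<noteq> 0"
  shows "0 < Re (G (R f) f)"
proof -
  have "R f \<noteq> 0"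
  proof
    assume "R f = 0"
    then have "G f f = 0" using R_rep[of f f] M.zero_left assms(1) by simp
    with G.pos[OF assms] show False by simp
  qed
  then show ?thesis using R_energy M.pos R_in assms(1) by simp
qed

end

definition trace_wrt ::
  "(('a \<Rightarrow> complex) \<Rightarrow> ('a \<Rightarrow> complex) \<Rightarrow> complex) \<Rightarrow> nat \<Rightarrow> (nat \<Rightarrow> 'a \<Rightarrow> complex) \<Rightarrow>
     (('a \<Rightarrow> complex) \<Rightarrow> 'a \<Rightarrow> complex) \<Rightarrow> real"
  where "trace_wrt G d u R = (\<Sum>l<d. Re (G (R (u l)) (u l)))"

text \<open>
  Every inner product has an inverse relative to \<open>G\<close>, with an explicit formula in an orthonormal
  basis of \<open>M\<close>.
\<close>
lemma basis_representation:
  assumes "pd_form V G" "pd_form V M" and b: "orthonormal_basis V M d b"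
  shows "represented_form V G M (\<lambda>f. lincomb d (\<lambda>j. G f (b j)) b)"
proof -
  interpret G: pd_form V G by fact
  interpret M: pd_form V M by fact
  have bV: "\<And>j. j < d \<Longrightarrow> b j \<in> V" using b by (simp add: orthonormal_basis_def)
  show ?thesis
  proof
    show "lincomb d (\<lambda>j. G f (b j)) b \<in> V" if "f \<in> V" for f
      by (rule G.V_lincomb) (rule bV)
    show "M (lincomb d (\<lambda>j. G f (b j)) b) g = G f g" if "f \<in> V" "g \<in> V" for f g
    proof -
      have "M (lincomb d (\<lambda>j. G f (b j)) b) g = (\<Sum>j<d. G f (b j) * M (b j) g)"
        using bV that by (intro M.lincomb_left) auto
      also have "\<dots> = (\<Sum>j<d. cnj (M g (b j)) * G f (b j))"
      proof (intro sum.cong refl)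
        fix j assume "j \<in> {..<d}"
        then have "M (b j) g = cnj (M g (b j))" by (intro M.herm bV that) simp
        then show "G f (b j) * M (b j) g = cnj (M g (b j)) * G f (b j)" by simp
      qed
      also have "\<dots> = G f (lincomb d (\<lambda>j. M g (b j)) b)"
        using bV that by (intro G.lincomb_right[symmetric]) auto
      also have "lincomb d (\<lambda>j. M g (b j)) b = g"
        using b that by (simp add: orthonormal_basis_def)
      finally show ?thesis .
    qed
  qed
qed

text \<open>
  The trace of the inverse of \<open>M\<close> is the sum of the \<open>G\<close>-square norms of an \<open>M\<close>-orthonormal basis \<open>b\<close>: expand
  each \<open>G (b j) (b j)\<close> by Parseval and exchange the two sums.
\<close>
lemma (in pd_form) basis_trace:
  assumes u: "orthonormal_basis V G d u" and bV: "\<And>j. j < d \<Longrightarrow> b j \<in> V"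
  shows "trace_wrt G d u (\<lambda>f. lincomb d (\<lambda>j. G f (b j)) b) = (\<Sum>j<d. Re (G (b j) (b j)))"
proof -
  have uV: "\<And>j. j < d \<Longrightarrow> u j \<in> V" using u by (simp add: orthonormal_basis_def)
  have "Re (G (lincomb d (\<lambda>j. G (u l) (b j)) b) (u l)) = (\<Sum>j<d. (cmod (G (b j) (u l)))\<^sup>2)"
    if l: "l < d" for l
  proof -
    have "G (lincomb d (\<lambda>j. G (u l) (b j)) b) (u l) = (\<Sum>j<d. G (u l) (b j) * G (b j) (u l))"
      using bV uV[OF l] by (intro lincomb_left) auto
    also have "\<dots> = (\<Sum>j<d. of_real ((cmod (G (b j) (u l)))\<^sup>2))"
    proof (intro sum.cong refl)
      fix j assume "j \<in> {..<d}"
      then have "G (u l) (b j) = cnj (G (b j) (u l))" by (intro herm bV uV l) simp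
      then show "G (u l) (b j) * G (b j) (u l) = of_real ((cmod (G (b j) (u l)))\<^sup>2)"
        unfolding complex_norm_square by (simp add: mult.commute)
    qed
    finally show ?thesis by simp
  qed
  then have "trace_wrt G d u (\<lambda>f. lincomb d (\<lambda>j. G f (b j)) b)
      = (\<Sum>l<d. \<Sum>j<d. (cmod (G (b j) (u l)))\<^sup>2)"
    by (simp add: trace_wrt_def)
  also have "\<dots> = (\<Sum>j<d. \<Sum>l<d. (cmod (G (b j) (u l)))\<^sup>2)" by (rule sum.swap)
  also have "\<dots> = (\<Sum>j<d. Re (G (b j) (b j)))"
    using Parseval_norm[OF u] bV by simp
  finally show ?thesis .
qed

context represented_form
begin

text \<open>
  The largest eigenvalue of the inverse of \<open>M\<close> is at most its trace. Here this is Cauchy-Schwarz for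
  \<open>M\<close>, applied to each coordinate \<open>G g (u l) = M g (R (u l))\<close>.
\<close>
lemma norm_le_trace:
  assumes u: "orthonormal_basis V G d u" and g: "g \<in> V"
  shows "Re (G g g) \<le> trace_wrt G d u R * Re (M g g)"
proof -
  have uV: "\<And>j. j < d \<Longrightarrow> u j \<in> V" using u by (simp add: orthonormal_basis_def)
  have "Re (G g g) = (\<Sum>l<d. (cmod (G g (u l)))\<^sup>2)" by (rule G.Parseval_norm[OF u g])
  also have "\<dots> \<le> (\<Sum>l<d. Re (G (R (u l)) (u l)) * Re (M g g))"
  proof (rule sum_mono)
    fix l assume "l \<in> {..<d}"
    then have l: "u l \<in> V" using uV by simp
    have "cmod (G g (u l)) = cmod (M (R (u l)) g)"
      using G.herm[OF g l] R_rep[OF l g] by simp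
    then have "(cmod (G g (u l)))\<^sup>2 \<le> Re (M (R (u l)) (R (u l))) * Re (M g g)"
      using M.Cauchy_Schwarz[OF R_in[OF l] g] by simp
    then show "(cmod (G g (u l)))\<^sup>2 \<le> Re (G (R (u l)) (u l)) * Re (M g g)"
      using R_energy[OF l] by simp
  qed
  finally show ?thesis by (simp add: trace_wrt_def sum_distrib_right)
qed

lemma trace_pos:
  assumes u: "orthonormal_basis V G d u" and "d \<ge> 1"
  shows "0 < trace_wrt G d u R"
proof -
  have uV: "\<And>j. j < d \<Longrightarrow> u j \<in> V" and u1: "\<And>j. j < d \<Longrightarrow> G (u j) (u j) = 1"
    using u by (auto simp: orthonormal_basis_def)
  have "u j \<noteq> 0" if "j < d" for j
    using u1[OF that] G.zero_left[OF G.V_0] by auto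
  then have "0 < Re (G (R (u j)) (u j))" if "j < d" for j using R_pos uV that by blast
  then show ?thesis unfolding trace_wrt_def using assms(2)
    by (intro sum_pos) (auto simp: lessThan_empty_iff)
qed

end

text \<open>
  Moving the barrier up by \<open>\<delta>\<close> replaces \<open>M\<close> by \<open>M' = M - \<delta> * G\<close>; \<open>R\<close> and \<open>R'\<close> are the inverses before and
  after.
\<close>
locale barrier_shift = G: pd_form V G +
  old: represented_form V G M R + new: represented_form V G M' R'
  for V :: "('a \<Rightarrow> complex) set" and G M R M' R' +
  fixes d :: nat and u :: "nat \<Rightarrow> 'a \<Rightarrow> complex" and \<delta> :: real
  assumes u: "orthonormal_basis V G d u" and d: "d \<ge> 1" and \<delta>: "\<delta> > 0"
    and M': "f \<in> V \<Longrightarrow> g \<in> V \<Longrightarrow> M' f g = M f g - of_real \<delta> * G f g"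
begin

lemma uV: "j < d \<Longrightarrow> u j \<in> V" using u by (simp add: orthonormal_basis_def)

lemma resolvent: "f \<in> V \<Longrightarrow> R' f = R f + smult (of_real \<delta>) (R (R' f))"
proof (rule old.M.nondegenerate)
  fix h assume f: "f \<in> V" and h: "h \<in> V"
  note V = f h old.R_in[OF f] new.R_in[OF f] old.R_in[OF new.R_in[OF f]]
  have "M (R' f) h = M' (R' f) h + of_real \<delta> * G (R' f) h" using M' V by simp
  also have "\<dots> = G f h + of_real \<delta> * M (R (R' f)) h" using V by (simp add: old.R_rep new.R_rep)
  also have "\<dots> = M (R f + smult (of_real \<delta>) (R (R' f))) h"
    using V by (simp add: old.M.add old.M.scale old.R_rep old.M.V_scale)
  finally show "M (R' f) h = M (R f + smult (of_real \<delta>) (R (R' f))) h" .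
qed (auto intro!: G.V_intros old.R_in new.R_in)

lemma resolvent': "f \<in> V \<Longrightarrow> R f = R' f - smult (of_real \<delta>) (R' (R f))"
proof (rule new.M.nondegenerate)
  fix h assume f: "f \<in> V" and h: "h \<in> V"
  note V = f h old.R_in[OF f] new.R_in[OF f] new.R_in[OF old.R_in[OF f]]
  have "M' (R f) h = M (R f) h - of_real \<delta> * G (R f) h" using M' V by simp
  also have "\<dots> = M' (R' f) h - of_real \<delta> * M' (R' (R f)) h"
    using V by (simp add: old.R_rep new.R_rep)
  also have "\<dots> = M' (R' f - smult (of_real \<delta>) (R' (R f))) h"
    using V by (simp add: new.M.diff_left new.M.scale new.M.V_scale)
  finally show "M' (R f) h = M' (R' f - smult (of_real \<delta>) (R' (R f))) h" .
qed (auto intro!: G.V_intros old.R_in new.R_in)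

lemma resolvents_commute: "f \<in> V \<Longrightarrow> R (R' f) = R' (R f)"
proof -
  assume f: "f \<in> V"
  have "of_real \<delta> * R (R' f) x = of_real \<delta> * R' (R f) x" for x
    using fun_cong[OF resolvent[OF f], of x] fun_cong[OF resolvent'[OF f], of x] by simp
  then show ?thesis using \<delta> by (simp add: fun_eq_iff)
qed

text \<open>
  The shift increases the trace from \<open>r\<close> to \<open>r' = r + \<tau>\<close>. The second inequality says that \<open>tr (R'\<^sup>2) - \<tau> * r' > \<tau>\<close>;
  by isotropy there is then a point whose rank-one contribution brings the trace back to \<open>r\<close>.

  With \<open>T = tr (R R')\<close> and \<open>Q = tr (R R'\<^sup>2)\<close>, the resolvent identity gives \<open>\<tau> = \<delta> * T\<close> and
  \<open>tr (R'\<^sup>2) = T + \<delta> * Q\<close>, and Cauchy-Schwarz gives \<open>T\<^sup>2 \<le> r * Q\<close>. Dropping the last term in the resulting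
  lower bound \<open>1 - \<delta> * (1 + r) + \<delta> * T * (1 - \<delta> * r) / r\<close> would lead to the
  usual condition \<open>\<delta> * (1 + \<epsilon>) \<le> 1\<close>. Keeping it, with \<open>T \<ge> r\<^sup>2 / d\<close>, leaves room for
  a slightly larger \<open>\<delta>\<close>.
\<close>
lemma trace_estimate:
  fixes \<epsilon> :: real
  defines "r \<equiv> trace_wrt G d u R" and "r' \<equiv> trace_wrt G d u R'"
  assumes r: "r \<le> \<epsilon>" and \<delta>\<epsilon>: "\<delta> * \<epsilon> < 1"
    and gain: "0 < 1 - \<delta> * (1 + \<epsilon>) + \<delta> * \<epsilon> * (1 - \<delta> * \<epsilon>) / d"
  shows "r' - r > 0" and "(\<Sum>l<d. Re (G (R' (u l)) (R' (u l)))) - (r' - r) * r' > r' - r"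
proof -
  define T where "T = (\<Sum>l<d. Re (G (R (R' (u l))) (u l)))"
  define Q where "Q = (\<Sum>l<d. Re (G (R (R' (u l))) (R' (u l))))"
  define P where "P = (\<Sum>l<d. Re (G (R' (u l)) (R' (u l))))"
  have r_pos: "r > 0" unfolding r_def by (rule old.trace_pos[OF u d])
  note V = uV old.R_in new.R_in
  have adj: "G (R' (u l)) (R (u l)) = G (R (R' (u l))) (u l)" if "l < d" for l
    using old.R_selfadjoint[of "R' (u l)" "u l"] V that by simp
  have adj': "Re (G (R (u l)) (R' (u l))) = Re (G (R (R' (u l))) (u l))" if "l < d" for l
    using adj[OF that] G.herm[of "R (u l)" "R' (u l)"] V that by simp
  have r': "r' = r + \<delta> * T"
  proof -
    have "G (R' (u l)) (u l) = G (R (u l)) (u l) + of_real \<delta> * G (R (R' (u l))) (u l)"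
      if "l < d" for l
      by (subst resolvent) (use V that in \<open>auto simp: G.add G.scale G.V_scale\<close>)
    then show ?thesis unfolding r'_def r_def T_def trace_wrt_def
      by (simp add: sum.distrib sum_distrib_left)
  qed
  have P: "P = T + \<delta> * Q"
  proof -
    have "Re (G (R' (u l)) (R' (u l))) =
        Re (G (R (R' (u l))) (u l)) + \<delta> * Re (G (R (R' (u l))) (R' (u l)))" if l: "l < d" for l
    proof -
      have "G (R' (u l)) (R' (u l)) = G (R (u l) + smult (of_real \<delta>) (R (R' (u l)))) (R' (u l))"
        using resolvent[OF uV[OF l]] by simp
      also have "\<dots> = G (R (u l)) (R' (u l)) + of_real \<delta> * G (R (R' (u l))) (R' (u l))"
        using V l by (simp add: G.add G.scale G.V_scale)
      finally show ?thesis using adj'[OF l] by simp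
    qed
    then show ?thesis unfolding P_def T_def Q_def by (simp add: sum.distrib sum_distrib_left)
  qed
  have T_ge: "r\<^sup>2 / d \<le> T"
  proof -
    have "r\<^sup>2 \<le> d * (\<Sum>l<d. (Re (G (R (u l)) (u l)))\<^sup>2)"
      unfolding r_def trace_wrt_def 
      using Cauchy_Schwarz_ineq_sum[of "\<lambda>_. 1" "\<lambda>l. Re (G (R (u l)) (u l))" "{..<d}"] by simp
    also have "(\<Sum>l<d. (Re (G (R (u l)) (u l)))\<^sup>2) \<le> T"
      unfolding T_def
    proof (rule sum_mono)
      fix l assume "l \<in> {..<d}"
      then have l: "l < d" by simp
      have u1: "G (u l) (u l) = 1" using u l by (auto simp: orthonormal_basis_def)
      have "(Re (G (R (u l)) (u l)))\<^sup>2 \<le> (cmod (G (R (u l)) (u l)))\<^sup>2"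
        by (metis abs_Re_le_cmod abs_ge_zero power2_abs power_mono)
      also have "\<dots> \<le> Re (G (R (u l)) (R (u l)))"
        using G.Cauchy_Schwarz[of "R (u l)" "u l"] u1 V l by simp
      also have "\<dots> \<le> Re (G (R (u l)) (R (u l))) + \<delta> * Re (G (R' (R (u l))) (R (u l)))"
        using new.R_nonneg[of "R (u l)"] \<delta> V l by simp
      also have "\<dots> = Re (G (R (u l) + smult (of_real \<delta>) (R (R' (u l)))) (R (u l)))"
        using V l by (simp add: G.add G.scale G.V_scale resolvents_commute)
      also have "\<dots> = Re (G (R' (u l)) (R (u l)))" using resolvent[OF uV[OF l]] by simp
      also have "\<dots> = Re (G (R (R' (u l))) (u l))" using adj[OF l] by simp
      finally show "(Re (G (R (u l)) (u l)))\<^sup>2 \<le> Re (G (R (R' (u l))) (u l))" .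
    qed
    finally show ?thesis using d by (simp add: field_simps)
  qed
  have T_pos: "T > 0" by (rule less_le_trans[OF _ T_ge]) (use r_pos d in simp)
  have CS: "T\<^sup>2 \<le> r * Q"
  proof -
    \<comment> \<open>Discriminant argument: this \<open>t\<close> is the value at which the quadratic \<open>r - 2 * t * T + t\<^sup>2 * Q\<close> gives the claim.\<close>
    define t where "t = r / T"
    have "0 \<le> (\<Sum>l<d. Re (G (R (u l - smult (of_real t) (R' (u l)))) (u l - smult (of_real t) (R' (u l)))))"
      by (intro sum_nonneg old.R_nonneg G.V_intros V) auto
    also have "\<dots> = (\<Sum>l<d. Re (G (R (u l)) (u l)) - 2 * t * Re (G (R (R' (u l))) (u l))
        + t\<^sup>2 * Re (G (R (R' (u l))) (R' (u l))))"
    proof (intro sum.cong refl)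
      fix l assume "l \<in> {..<d}"
      then have l: "l < d" by simp
      have R_eq: "R (u l - smult (of_real t) (R' (u l))) = R (u l) - smult (of_real t) (R (R' (u l)))"
        using V l by (intro old.R_diff_smult) auto
      then show "Re (G (R (u l - smult (of_real t) (R' (u l)))) (u l - smult (of_real t) (R' (u l))))
        = Re (G (R (u l)) (u l)) - 2 * t * Re (G (R (R' (u l))) (u l))
        + t\<^sup>2 * Re (G (R (R' (u l))) (R' (u l)))"
        unfolding R_eq using V l adj'[OF l]
        by (simp add: G.diff_left G.diff_right G.scale G.scale_right G.V_scale G.V_diff
            power2_eq_square algebra_simps)
    qed
    also have "\<dots> = r - 2 * t * T + t\<^sup>2 * Q"
      unfolding r_def T_def Q_def trace_wrt_def
      by (simp add: sum.distrib sum_subtractf sum_distrib_left)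
    also have "\<dots> = - r + r\<^sup>2 * Q / T\<^sup>2" using T_pos by (simp add: t_def power_divide)
    finally have "r * T\<^sup>2 \<le> r * (r * Q)" using T_pos
      by (simp add: field_simps power2_eq_square)
    then show ?thesis using r_pos by simp
  qed
  show "r' - r > 0" using r' T_pos \<delta> by simp
  \<comment> \<open>The gain is a decreasing function of the trace, so it suffices to know it for \<open>r = \<epsilon>\<close>.\<close>
  have phi: "0 < 1 - \<delta> * (1 + r) + \<delta> * r * (1 - \<delta> * r) / d"
  proof -
    have "0 \<le> \<delta> * (\<epsilon> - r) * (1 - 1 / d + \<delta> * (r + \<epsilon>) / d)"
      using r r_pos \<delta> d by (intro mult_nonneg_nonneg add_nonneg_nonneg) auto
    also have "\<dots> = (1 - \<delta> * (1 + r) + \<delta> * r * (1 - \<delta> * r) / d)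
        - (1 - \<delta> * (1 + \<epsilon>) + \<delta> * \<epsilon> * (1 - \<delta> * \<epsilon>) / d)"
      by (simp add: divide_inverse algebra_simps)
    finally show ?thesis using gain by linarith
  qed
  have "\<delta> * r < 1" using mult_left_mono[OF r, of \<delta>] \<delta> \<delta>\<epsilon> by linarith
  then have "r\<^sup>2 / d * (\<delta> * (1 - \<delta> * r) / r) \<le> T * (\<delta> * (1 - \<delta> * r) / r)"
    using T_ge \<delta> r_pos by (intro mult_right_mono) auto
  moreover have "r\<^sup>2 / d * (\<delta> * (1 - \<delta> * r) / r) = \<delta> * r * (1 - \<delta> * r) / d"
    using r_pos by (simp add: power2_eq_square)
  ultimately have "0 < 1 - \<delta> * (1 + r) + T * (\<delta> * (1 - \<delta> * r) / r)" using phi by linarith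
  then have "0 < T * (1 - \<delta> * (1 + r) + T * (\<delta> * (1 - \<delta> * r) / r))" using T_pos by simp
  also have "\<dots> = T + \<delta> * (T\<^sup>2 / r) - \<delta> * T * (r + \<delta> * T) - \<delta> * T"
    using r_pos by (simp add: field_simps power2_eq_square)
  also have "\<dots> \<le> T + \<delta> * Q - \<delta> * T * (r + \<delta> * T) - \<delta> * T"
    using CS r_pos \<delta> by (simp add: field_simps)
  finally show "(\<Sum>l<d. Re (G (R' (u l)) (R' (u l)))) - (r' - r) * r' > r' - r"
    using P r' by (simp add: P_def)
qed

end

section \<open>Greedy selection of sampling points\<close>

text \<open>
  If \<open>G f g\<close> is the average of \<open>f x * cnj (g x)\<close> over a probability measure on \<open>D\<close>, the property
  holds because a function somewhere reaches its average; with \<open>\<le>\<close> the inequality even holds for \<open>\<eta> = 0\<close>. The slack \<open>\<eta>\<close> is there for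
  inner products that are limits of such averages, as a supremum over \<open>D\<close> need not be attained.
  The weights \<open>w\<close> may be negative.
\<close>
definition isotropic ::
  "'a set \<Rightarrow> ('a \<Rightarrow> complex) set \<Rightarrow> (('a \<Rightarrow> complex) \<Rightarrow> ('a \<Rightarrow> complex) \<Rightarrow> complex) \<Rightarrow> bool" where
  "isotropic D V G \<longleftrightarrow> (\<forall>N (w :: nat \<Rightarrow> real) h \<eta>. (\<forall>i<N. h i \<in> V) \<longrightarrow> \<eta> > 0 \<longrightarrow>
     (\<exists>x\<in>D. (\<Sum>i<N. w i * Re (G (h i) (h i))) - \<eta> < (\<Sum>i<N. w i * (cmod (h i x))\<^sup>2)))"

lemma isotropicD:
  fixes N :: nat
  assumes "isotropic D V G" "\<And>i. i < N \<Longrightarrow> h i \<in> V" "\<eta> > 0"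
  obtains x where "x \<in> D"
    "(\<Sum>i<N. w i * Re (G (h i) (h i))) - \<eta> < (\<Sum>i<N. w i * (cmod (h i x))\<^sup>2)"
proof -
  have "\<exists>x\<in>D. (\<Sum>i<N. w i * Re (G (h i) (h i))) - \<eta> < (\<Sum>i<N. w i * (cmod (h i x))\<^sup>2)"
    by (rule assms(1)[unfolded isotropic_def, rule_format]) (use assms in auto)
  with that show thesis by blast
qed

lemma sum_lessThan_add:
  fixes f :: "nat \<Rightarrow> 'b::comm_monoid_add"
  shows "(\<Sum>i<a + b. f i) = (\<Sum>i<a. f i) + (\<Sum>j<b. f (a + j))"
  by (induction b) (auto simp: add.assoc)

lemma (in pd_form) pd_form_add_point:
  "pd_form V (\<lambda>f g. G f g + f x * cnj (g x))"
proof
  fix f g :: "'a \<Rightarrow> complex" assume "f \<in> V" "g \<in> V"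
  then show "G f g + f x * cnj (g x) = cnj (G g f + g x * cnj (f x))"
    using herm[of f g] by simp
next
  fix f assume f: "f \<in> V" "f \<noteq> 0"
  have "f x * cnj (f x) = of_real ((cmod (f x))\<^sup>2)" by (rule complex_norm_square[symmetric])
  then show "0 < Re (G f f + f x * cnj (f x))" using pos[OF f] by (simp add: add_pos_nonneg)
qed (auto simp: sub add scale algebra_simps)

text \<open>
  One round of the selection: shift the barrier by \<open>\<delta>\<close>, then add a point \<open>x\<close> that compensates for the shift.
  The functional \<open>g \<mapsto> g x\<close> is represented by some \<open>k \<in> V\<close>, and the Sherman-Morrison formula gives the inverse
  after the addition of the point. It lowers the trace by \<open>(\<Sum>l<d. (cmod (R' (u l) x))\<^sup>2) / (1 + s)\<close> with
  \<open>s = R' k x = (\<Sum>j<d. (cmod (b j x))\<^sup>2)\<close>. This amount is at least \<open>\<tau>\<close> iff a weighted sum of squares of values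
  at \<open>x\<close>, with weights \<open>1\<close> and \<open>- \<tau>\<close>, is at least \<open>\<tau>\<close>; so isotropy and \<open>trace_estimate\<close> provide \<open>x\<close>.
\<close>
lemma (in pd_form) barrier_step:
  fixes \<delta> \<epsilon> :: real
  assumes "pd_form V M" "represented_form V G M R"
    and u: "orthonormal_basis V G d u" and d: "d \<ge> 1" "cfun.dim V = d"
    and iso: "isotropic D V G"
    and \<delta>: "\<delta> > 0" "\<delta> * \<epsilon> < 1" "0 < 1 - \<delta> * (1 + \<epsilon>) + \<delta> * \<epsilon> * (1 - \<delta> * \<epsilon>) / d"
    and tr: "trace_wrt G d u R \<le> \<epsilon>"
  obtains x R'' where "x \<in> D"
    and "represented_form V G (\<lambda>f g. M f g - of_real \<delta> * G f g + f x * cnj (g x)) R''"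
    and "trace_wrt G d u R'' \<le> \<epsilon>"
proof -
  interpret old: represented_form V G M R by fact
  have uV: "\<And>j. j < d \<Longrightarrow> u j \<in> V" using u by (simp add: orthonormal_basis_def)
  define M' where "M' = (\<lambda>f g. M f g - of_real \<delta> * G f g)"
  interpret M': pd_form V M'
  proof
    fix f g :: "'a \<Rightarrow> complex" assume "f \<in> V" "g \<in> V"
    then show "M' f g = cnj (M' g f)"
      using herm[of f g] old.M.herm[of f g] by (simp add: M'_def)
  next
    fix f assume f: "f \<in> V" "f \<noteq> 0"
    have Mf: "Re (M f f) > 0" by (rule old.M.pos[OF f])
    have "Re (G f f) \<le> \<epsilon> * Re (M f f)"
      using old.norm_le_trace[OF u f(1)] mult_right_mono[OF tr, of "Re (M f f)"] Mf by linarith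
    then have "\<delta> * Re (G f f) \<le> \<delta> * (\<epsilon> * Re (M f f))" using \<delta>(1) by (intro mult_left_mono) auto
    also have "\<dots> = (\<delta> * \<epsilon>) * Re (M f f)" by simp
    also have "\<dots> < 1 * Re (M f f)" using \<delta>(2) Mf by (intro mult_strict_right_mono)
    finally show "0 < Re (M' f f)" by (simp add: M'_def)
  qed (auto simp: sub add scale old.M.add old.M.scale algebra_simps M'_def)
  obtain b where b: "orthonormal_basis V M' d b"
    using M'.orthonormal_basis_exists d by blast
  have bV: "\<And>j. j < d \<Longrightarrow> b j \<in> V" using b by (simp add: orthonormal_basis_def)
  define R' where "R' = (\<lambda>f. lincomb d (\<lambda>j. G f (b j)) b)"
  interpret new: represented_form V G M' R'
    unfolding R'_def by (rule basis_representation[OF pd_form_axioms M'.pd_form_axioms b])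
  interpret shift: barrier_shift V G M R M' R' d u \<delta>
    by unfold_locales (rule u d \<delta> refl | simp add: M'_def)+
  define r' where "r' = trace_wrt G d u R'"
  define \<tau> where "\<tau> = r' - trace_wrt G d u R"
  have \<tau>: "\<tau> > 0" and gap: "\<tau> < (\<Sum>l<d. Re (G (R' (u l)) (R' (u l)))) - \<tau> * r'"
    using shift.trace_estimate[OF tr \<delta>(2,3)] by (simp_all add: \<tau>_def r'_def)
  have r'_b: "r' = (\<Sum>j<d. Re (G (b j) (b j)))"
    unfolding r'_def R'_def by (rule basis_trace[OF u bV])
  \<comment> \<open>The test family for isotropy: its first half collects \<open>tr (R'\<^sup>2)\<close> and its second half \<open>tr R'\<close>.\<close>
  define h where "h = (\<lambda>i. if i < d then R' (u i) else b (i - d))"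
  define w where "w = (\<lambda>i. if i < d then 1 else - \<tau>)"
  have hV: "\<forall>i<d+d. h i \<in> V" unfolding h_def using new.R_in uV bV by auto
  obtain x where x: "x \<in> D" and "(\<Sum>i<d+d. w i * Re (G (h i) (h i))) -
      ((\<Sum>l<d. Re (G (R' (u l)) (R' (u l)))) - \<tau> * r' - \<tau>) < (\<Sum>i<d+d. w i * (cmod (h i x))\<^sup>2)"
    by (rule isotropicD[OF iso, of "d + d" h _ w]) (use hV gap in auto)
  then have good: "\<tau> < (\<Sum>l<d. (cmod (R' (u l) x))\<^sup>2) - \<tau> * (\<Sum>j<d. (cmod (b j x))\<^sup>2)"
    unfolding sum_lessThan_add r'_b
    by (simp add: h_def w_def sum_distrib_left sum_negf)
  define s where "s = (\<Sum>j<d. (cmod (b j x))\<^sup>2)"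
  have s: "s \<ge> 0" unfolding s_def by (intro sum_nonneg) auto
  define k where "k = lincomb d (\<lambda>l. cnj (u l x)) u"
  have kV: "k \<in> V" unfolding k_def by (rule V_lincomb) (rule uV)
  have k: "G g k = g x" if "g \<in> V" for g
  proof -
    have "G g k = (\<Sum>l<d. G g (u l) * u l x)"
      unfolding k_def using uV that by (subst lincomb_right) (auto simp: mult.commute)
    also have "\<dots> = lincomb d (\<lambda>l. G g (u l)) u x" by (simp add: lincomb_def)
    also have "lincomb d (\<lambda>l. G g (u l)) u = g"
      using u that by (simp add: orthonormal_basis_def)
    finally show ?thesis .
  qed
  have k': "G k g = cnj (g x)" if "g \<in> V" for g
    using herm[OF kV that] k[OF that] by simp
  have R'k: "R' k x = of_real s"
  proof -
    have "R' k x = (\<Sum>j<d. cnj (b j x) * b j x)"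
      using k'[OF bV] by (simp add: R'_def lincomb_def)
    also have "\<dots> = of_real s" unfolding s_def of_real_sum complex_norm_square
      by (simp add: mult.commute)
    finally show ?thesis .
  qed
  define M'' where "M'' = (\<lambda>f g. M' f g + f x * cnj (g x))"
  interpret M'': pd_form V M'' unfolding M''_def by (rule M'.pd_form_add_point)
  define c where "c = 1 / (1 + s)"
  define R'' where "R'' = (\<lambda>f. R' f - smult (of_real c * R' f x) (R' k))"
  have cs: "of_real c * of_real s = (1 - of_real c :: complex)"
  proof -
    have "c * s = 1 - c" using s by (simp add: c_def field_simps)
    then show ?thesis by (metis of_real_1 of_real_diff of_real_mult)
  qed
  have rep: "represented_form V G M'' R''"
  proof
    fix f g assume f: "f \<in> V" and g: "g \<in> V"
    show "R'' f \<in> V" unfolding R''_def by (intro V_intros new.R_in f kV)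
    have "M'' (R'' f) g = M'' (R' f) g - of_real c * R' f x * M'' (R' k) g"
      unfolding R''_def using f g kV new.R_in
      by (simp add: M''.diff_left M''.scale M''.V_scale)
    also have "M'' (R' f) g = G f g + R' f x * cnj (g x)"
      using f g by (simp add: M''_def new.R_rep)
    also have "M'' (R' k) g = cnj (g x) + of_real s * cnj (g x)"
      using kV g by (simp add: M''_def new.R_rep k' R'k)
    also have "G f g + R' f x * cnj (g x) - of_real c * R' f x * (cnj (g x) + of_real s * cnj (g x))
        = G f g + R' f x * cnj (g x) - R' f x * cnj (g x) * (of_real c + of_real c * of_real s)"
      by (simp add: algebra_simps)
    also have "\<dots> = G f g" unfolding cs by simp
    finally show "M'' (R'' f) g = G f g" .
  qed
  have "trace_wrt G d u R'' = r' - c * (\<Sum>l<d. (cmod (R' (u l) x))\<^sup>2)"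
  proof -
    have "Re (G (R'' (u l)) (u l)) = Re (G (R' (u l)) (u l)) - c * (cmod (R' (u l) x))\<^sup>2"
      if l: "l < d" for l
    proof -
      note V = uV[OF l] new.R_in[OF uV[OF l]] new.R_in[OF kV] kV
      have "G (R' k) (u l) = cnj (R' (u l) x)"
        using new.R_selfadjoint[OF V(4,1)] k'[OF V(2)] by simp
      then have "G (R'' (u l)) (u l) =
          G (R' (u l)) (u l) - of_real c * (R' (u l) x * cnj (R' (u l) x))"
        unfolding R''_def using V by (simp add: diff_left scale V_scale)
      then show ?thesis unfolding complex_norm_square[symmetric] by simp
    qed
    then show ?thesis by (simp add: trace_wrt_def r'_def sum_subtractf sum_distrib_left)
  qed
  also have "\<dots> \<le> r' - \<tau>"
    using good s by (simp add: c_def s_def[symmetric] field_simps)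
  also have "\<dots> \<le> \<epsilon>" using tr by (simp add: \<tau>_def)
  finally show ?thesis using that[OF x, of R''] rep by (simp add: M''_def M'_def)
qed

text \<open>
  The barrier starts at \<open>- d / \<epsilon>\<close>, where the inverse of \<open>(d / \<epsilon>) * G\<close> has trace exactly \<open>\<epsilon>\<close>.
\<close>
lemma (in pd_form) barrier_iterate:
  fixes \<delta> \<epsilon> :: real and n :: nat
  assumes u: "orthonormal_basis V G d u" and d: "d \<ge> 1" "cfun.dim V = d"
    and iso: "isotropic D V G"
    and \<delta>: "\<delta> > 0" "\<epsilon> > 0" "\<delta> * \<epsilon> < 1" "0 < 1 - \<delta> * (1 + \<epsilon>) + \<delta> * \<epsilon> * (1 - \<delta> * \<epsilon>) / d"
  shows "\<exists>x R. (\<forall>i\<in>{1..n}. x i \<in> D) \<and> trace_wrt G d u R \<le> \<epsilon> \<and>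
    represented_form V G
      (\<lambda>f g. (\<Sum>i=1..n. f (x i) * cnj (g (x i))) - of_real (n * \<delta> - d / \<epsilon>) * G f g) R"
proof (induction n)
  case (0)
  define c where "c = d / \<epsilon>"
  have c: "c > 0" using d \<delta> by (simp add: c_def)
  have uV: "\<And>j. j < d \<Longrightarrow> u j \<in> V" and u1: "\<And>j. j < d \<Longrightarrow> G (u j) (u j) = 1"
    using u by (auto simp: orthonormal_basis_def)
  define M where "M = (\<lambda>f g. of_real c * G f g)"
  interpret M: pd_form V M
  proof
    fix f g :: "'a \<Rightarrow> complex" assume "f \<in> V" "g \<in> V"
    then show "M f g = cnj (M g f)" using herm[of f g] by (simp add: M_def)
  qed (use c in \<open>auto simp: sub add scale pos algebra_simps M_def\<close>)
  have "represented_form V G M (\<lambda>f. smult (of_real (1 / c)) f)"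
  proof
    have inv: "(of_real c :: complex) * of_real (1 / c) = 1"
      using c unfolding of_real_mult[symmetric] by simp
    show "M (smult (of_real (1 / c)) f) g = G f g" if "f \<in> V" "g \<in> V" for f g
      unfolding M_def scale[OF that] mult.assoc[symmetric] inv by simp
  qed (rule V_scale)
  moreover have "trace_wrt G d u (\<lambda>f. smult (of_real (1 / c)) f) = \<epsilon>"
    using d u1 uV by (simp add: trace_wrt_def scale c_def del: of_real_divide)
  moreover have "M = (\<lambda>f g. (\<Sum>i=1..(0::nat). f (x i) * cnj (g (x i))) - of_real (real 0 * \<delta> - d / \<epsilon>) * G f g)" for x
    by (simp add: M_def c_def)
  ultimately show ?case by (intro exI[of _ "\<lambda>f. smult (of_real (1 / c)) f"] exI) auto
next
  case (Suc n)
  define l where "l = n * \<delta> - d / \<epsilon>"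
  from Suc obtain x R where x: "\<And>i. i \<in> {1..n} \<Longrightarrow> x i \<in> D"
    and tr: "trace_wrt G d u R \<le> \<epsilon>"
    and rep: "represented_form V G (\<lambda>f g. (\<Sum>i=1..n. f (x i) * cnj (g (x i))) - of_real l * G f g) R"
    unfolding l_def by blast
  obtain y R' where y: "y \<in> D" and tr': "trace_wrt G d u R' \<le> \<epsilon>"
    and rep': "represented_form V G (\<lambda>f g. (\<Sum>i=1..n. f (x i) * cnj (g (x i))) - of_real l * G f g
        - of_real \<delta> * G f g + f y * cnj (g y)) R'"
    using barrier_step[OF represented_form.axioms(2)[OF rep] rep u d iso \<delta>(1,3,4) tr] by blast
  define x' where "x' = x(Suc n := y)"
  have eq: "(\<lambda>f g. (\<Sum>i=1..n. f (x i) * cnj (g (x i))) - of_real l * G f g - of_real \<delta> * G f g + f y * cnj (g y))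
    = (\<lambda>f g. (\<Sum>i=1..Suc n. f (x' i) * cnj (g (x' i))) - of_real (Suc n * \<delta> - d / \<epsilon>) * G f g)"
  proof (intro ext)
    fix f g :: "'a \<Rightarrow> complex"
    have "(\<Sum>i=1..n. f (x' i) * cnj (g (x' i))) = (\<Sum>i=1..n. f (x i) * cnj (g (x i)))"
      by (intro sum.cong) (auto simp: x'_def)
    then show "(\<Sum>i=1..n. f (x i) * cnj (g (x i))) - of_real l * G f g - of_real \<delta> * G f g + f y * cnj (g y)
      = (\<Sum>i=1..Suc n. f (x' i) * cnj (g (x' i))) - of_real (Suc n * \<delta> - d / \<epsilon>) * G f g"
      by (simp add: x'_def l_def algebra_simps)
  qed
  have "\<forall>i\<in>{1..Suc n}. x' i \<in> D" using x y by (auto simp: x'_def le_Suc_eq)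
  with tr' rep' show ?case unfolding eq by blast
qed

text \<open>
  With \<open>\<epsilon> = sqrt d / (sqrt n - sqrt d)\<close> and the critical step \<open>1 / (1 + \<epsilon>)\<close>, the final barrier is exactly
  \<open>(sqrt n - sqrt d)\<^sup>2\<close>. At this step the gain is still positive, so by continuity the step can be enlarged.
\<close>
lemma barrier_parameters:
  fixes d n :: nat
  assumes "d \<ge> 1" "n > d"
  obtains \<delta> \<epsilon> :: real where "\<delta> > 0" "\<epsilon> > 0" "\<delta> * \<epsilon> < 1"
    "0 < 1 - \<delta> * (1 + \<epsilon>) + \<delta> * \<epsilon> * (1 - \<delta> * \<epsilon>) / d"
    "n * \<delta> - d / \<epsilon> > (sqrt n - sqrt d)\<^sup>2"
proof -
  define a b where "a = sqrt d" and "b = sqrt n"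
  have ab: "0 < a" "a < b" using assms by (auto simp: a_def b_def)
  define \<epsilon> where "\<epsilon> = a / (b - a)"
  have \<epsilon>: "\<epsilon> > 0" using ab by (simp add: \<epsilon>_def)
  define \<delta>0 where "\<delta>0 = 1 / (1 + \<epsilon>)"
  have \<delta>0: "\<delta>0 > 0" "\<delta>0 * (1 + \<epsilon>) = 1" "\<delta>0 * \<epsilon> < 1" using \<epsilon> by (auto simp: \<delta>0_def field_simps)
  have "isCont (\<lambda>\<delta>. 1 - \<delta> * (1 + \<epsilon>) + \<delta> * \<epsilon> * (1 - \<delta> * \<epsilon>) / d) \<delta>0"
    using assms by (intro continuous_intros) auto
  then have lim: "((\<lambda>\<delta>. 1 - \<delta> * (1 + \<epsilon>) + \<delta> * \<epsilon> * (1 - \<delta> * \<epsilon>) / d) \<longlongrightarrow>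
      1 - \<delta>0 * (1 + \<epsilon>) + \<delta>0 * \<epsilon> * (1 - \<delta>0 * \<epsilon>) / d) (at_right \<delta>0)"
    unfolding isCont_def by (rule tendsto_within_subset) auto
  have "0 < 1 - \<delta>0 * (1 + \<epsilon>) + \<delta>0 * \<epsilon> * (1 - \<delta>0 * \<epsilon>) / d"
    using \<delta>0 \<epsilon> assms by simp
  from order_tendstoD(1)[OF lim this]
  have 1: "\<forall>\<^sub>F \<delta> in at_right \<delta>0. 0 < 1 - \<delta> * (1 + \<epsilon>) + \<delta> * \<epsilon> * (1 - \<delta> * \<epsilon>) / d" .
  have 2: "\<forall>\<^sub>F \<delta> in at_right \<delta>0. \<delta> < 1 / \<epsilon>"
    using \<delta>0 \<epsilon> by (intro order_tendstoD(2)[OF tendsto_ident_at]) (auto simp: field_simps)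
  have 3: "\<forall>\<^sub>F \<delta> in at_right \<delta>0. \<delta>0 < \<delta>" by (rule eventually_at_right_less)
  obtain \<delta> where \<delta>: "0 < 1 - \<delta> * (1 + \<epsilon>) + \<delta> * \<epsilon> * (1 - \<delta> * \<epsilon>) / d" "\<delta> < 1 / \<epsilon>" "\<delta>0 < \<delta>"
    using eventually_happens[OF eventually_conj[OF 1 eventually_conj[OF 2 3]]] by auto
  have "(b - a)\<^sup>2 = b\<^sup>2 * \<delta>0 - a\<^sup>2 / \<epsilon>"
  proof -
    have "\<delta>0 = (b - a) / b" using ab by (simp add: \<delta>0_def \<epsilon>_def field_simps)
    moreover have "a\<^sup>2 / \<epsilon> = a * (b - a)" using ab by (simp add: \<epsilon>_def power2_eq_square)
    moreover have "b\<^sup>2 * ((b - a) / b) = b * (b - a)" using ab by (simp add: power2_eq_square)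
    ultimately show ?thesis by (simp add: power2_eq_square algebra_simps)
  qed
  also have "\<dots> < b\<^sup>2 * \<delta> - a\<^sup>2 / \<epsilon>" using \<delta>(3) ab by simp
  finally have "(sqrt n - sqrt d)\<^sup>2 < n * \<delta> - d / \<epsilon>" by (simp add: a_def b_def)
  moreover have "\<delta> > 0" "\<delta> * \<epsilon> < 1" using \<delta> \<delta>0 \<epsilon> by (auto simp: field_simps)
  ultimately show ?thesis using that \<delta>(1) \<epsilon> by blast
qed

text \<open>
  The final positions of the barrier that the selection can reach. They depend on \<open>d\<close> and \<open>n\<close>
  only, so one of them can be fixed before the inner product is chosen.
\<close>
definition sampling_constant :: "nat \<Rightarrow> nat \<Rightarrow> real \<Rightarrow> bool" where
  "sampling_constant d n c \<longleftrightarrow> (\<exists>\<delta> \<epsilon> :: real. \<delta> > 0 \<and> \<epsilon> > 0 \<and> \<delta> * \<epsilon> < 1 \<and>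
     0 < 1 - \<delta> * (1 + \<epsilon>) + \<delta> * \<epsilon> * (1 - \<delta> * \<epsilon>) / d \<and> c = n * \<delta> - d / \<epsilon>)"

lemma sampling_constant_exists:
  assumes "d \<ge> 1" "n > d"
  obtains c where "sampling_constant d n c" "c > (sqrt n - sqrt d)\<^sup>2"
  using barrier_parameters[OF assms] unfolding sampling_constant_def by metis

lemma (in pd_form) isotropic_sampling:
  assumes d: "d \<ge> 1" "cfun.dim V = d" and iso: "isotropic D V G"
    and c: "sampling_constant d n c"
  obtains x where "\<And>i. i \<in> {1..n} \<Longrightarrow> x i \<in> D"
    and "\<And>g. g \<in> V \<Longrightarrow> c * Re (G g g) \<le> (\<Sum>i=1..n. (cmod (g (x i)))\<^sup>2)"
proof -
  obtain \<delta> \<epsilon> :: real where \<delta>: "\<delta> > 0" "\<epsilon> > 0" "\<delta> * \<epsilon> < 1"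
    "0 < 1 - \<delta> * (1 + \<epsilon>) + \<delta> * \<epsilon> * (1 - \<delta> * \<epsilon>) / d" and c': "c = n * \<delta> - d / \<epsilon>"
    using c unfolding sampling_constant_def by blast
  obtain u where u: "orthonormal_basis V G d u" using orthonormal_basis_exists d by blast
  obtain x R where x: "\<And>i. i \<in> {1..n} \<Longrightarrow> x i \<in> D" and
    rep: "represented_form V G (\<lambda>f g. (\<Sum>i=1..n. f (x i) * cnj (g (x i))) - of_real c * G f g) R"
    using barrier_iterate[OF u d iso \<delta>, of n] unfolding c' by blast
  interpret M: pd_form V "\<lambda>f g. (\<Sum>i=1..n. f (x i) * cnj (g (x i))) - of_real c * G f g"
    by (rule represented_form.axioms(2)[OF rep])
  show ?thesis
  proof
    fix g assume "g \<in> V"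
    from M.nonneg[OF this] show "c * Re (G g g) \<le> (\<Sum>i=1..n. (cmod (g (x i)))\<^sup>2)"
      unfolding complex_norm_square[symmetric] by simp
  qed (use x in auto)
qed

section \<open>Pointwise compactness and best uniform approximation\<close>

definition sample_form :: "'i set \<Rightarrow> ('i \<Rightarrow> 'a) \<Rightarrow> ('a \<Rightarrow> complex) \<Rightarrow> ('a \<Rightarrow> complex) \<Rightarrow> complex" where
  "sample_form I x f g = (\<Sum>i\<in>I. f (x i) * cnj (g (x i)))"

lemma sample_form_diag: "sample_form I x f f = of_real (\<Sum>i\<in>I. (cmod (f (x i)))\<^sup>2)"
  unfolding sample_form_def of_real_sum complex_norm_square ..

lemma pd_sample_form:
  assumes "finite I" "cfun.subspace V"
    and inj: "\<And>g. g \<in> V \<Longrightarrow> (\<And>i. i \<in> I \<Longrightarrow> g (x i) = 0) \<Longrightarrow> g = 0"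
  shows "pd_form V (sample_form I x)"
proof
  show "cfun.subspace V" by fact
  fix f assume f: "f \<in> V" "f \<noteq> 0"
  then obtain i where "i \<in> I" "f (x i) \<noteq> 0" using inj by blast
  then show "0 < Re (sample_form I x f f)"
    unfolding sample_form_diag Re_complex_of_real
    by (intro sum_pos2[of I i]) (use assms in auto)
qed (auto simp: sample_form_def sum.distrib sum_distrib_left algebra_simps)

definition supported_on :: "'a set \<Rightarrow> ('a \<Rightarrow> complex) set" where
  "supported_on D = {f. \<forall>x. x \<notin> D \<longrightarrow> f x = 0}"

lemma supported_onD: "V \<subseteq> supported_on D \<Longrightarrow> f \<in> V \<Longrightarrow> x \<notin> D \<Longrightarrow> f x = 0"
  by (auto simp: supported_on_def)

text \<open>
  If the points \<open>Z\<close> determine the functions in the span of \<open>B\<close>, then the functions in the span of \<open>insert a B\<close>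
  that vanish on \<open>Z\<close> form a space of dimension at most one, so one further point suffices.
\<close>
lemma unisolvent_points_span:
  assumes "finite B" "B \<subseteq> V" "cfun.subspace V" "V \<subseteq> supported_on D"
  shows "\<exists>Z. finite Z \<and> Z \<subseteq> D \<and> (\<forall>g\<in>cfun.span B. (\<forall>z\<in>Z. g z = 0) \<longrightarrow> g = 0)"
  using assms(1,2)
proof (induction B rule: finite_induct)
  case empty
  then show ?case by (intro exI[of _ "{}"]) (auto simp: zero_fun_def)
next
  case (insert a B)
  have "B \<subseteq> V" using insert.prems by simp
  from insert.IH[OF this] obtain Z where Z: "finite Z" "Z \<subseteq> D"
    and uni': "\<forall>g\<in>cfun.span B. (\<forall>z\<in>Z. g z = 0) \<longrightarrow> g = 0" by (elim exE conjE)
  have uni: "g = 0" if "g \<in> cfun.span B" "\<And>z. z \<in> Z \<Longrightarrow> g z = 0" for g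
    by (rule uni'[rule_format]) (use that in auto)
  have spV: "cfun.span (insert a B) \<subseteq> V" by (rule cfun.span_minimal[OF insert.prems assms(3)])
  show ?case
  proof (cases "\<exists>g\<in>cfun.span (insert a B). (\<forall>z\<in>Z. g z = 0) \<and> g \<noteq> 0")
    case False
    then show ?thesis using Z by blast
  next
    case True
    then obtain g where g: "g \<in> cfun.span (insert a B)" "\<And>z. z \<in> Z \<Longrightarrow> g z = 0" "g \<noteq> 0" by blast
    obtain x where x: "g x \<noteq> 0" using g(3) by (auto simp: fun_eq_iff)
    have xD: "x \<in> D" using supported_onD[OF assms(4), of g x] g(1) spV x by blast
    obtain \<alpha> where \<alpha>: "g - smult \<alpha> a \<in> cfun.span B"
      using g(1) cfun.span_breakdown_eq[of g a B] by (auto simp: smult_def)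
    have "\<alpha> \<noteq> 0"
    proof
      assume "\<alpha> = 0"
      then have "g \<in> cfun.span B" using \<alpha> by (simp add: smult_0)
      from uni[OF this g(2)] g(3) show False by simp
    qed
    have "h = 0" if h: "h \<in> cfun.span (insert a B)" "\<And>z. z \<in> insert x Z \<Longrightarrow> h z = 0" for h
    proof -
      obtain \<beta> where \<beta>: "h - smult \<beta> a \<in> cfun.span B"
        using h(1) cfun.span_breakdown_eq[of h a B] by (auto simp: smult_def)
      define k where "k = (h - smult \<beta> a) - smult (\<beta> / \<alpha>) (g - smult \<alpha> a)"
      have kB: "k \<in> cfun.span B" unfolding k_def
        by (intro cfun.span_diff subspace_smult cfun.subspace_span \<alpha> \<beta>)
      have k: "k y = h y - \<beta> / \<alpha> * g y" for y using \<open>\<alpha> \<noteq> 0\<close> by (simp add: k_def algebra_simps)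
      have "k = 0" by (rule uni[OF kB]) (simp add: k g(2) h(2))
      then have hg: "h y = \<beta> / \<alpha> * g y" for y using k[of y] by (simp)
      have "\<beta> / \<alpha> = 0" using hg[of x] h(2)[of x] x by (simp only: mult_eq_0_iff) auto
      then show "h = 0" using hg by (auto simp: fun_eq_iff)
    qed
    then have "\<forall>h\<in>cfun.span (insert a B). (\<forall>z\<in>insert x Z. h z = 0) \<longrightarrow> h = 0" by blast
    moreover have "finite (insert x Z)" "insert x Z \<subseteq> D" using Z xD by auto
    ultimately show ?thesis by blast
  qed
qed

lemma unisolvent_points:
  assumes "cfun.subspace V" "V \<subseteq> supported_on D" "cfun.dim V = d" "d \<ge> 1"
  obtains Z where "finite Z" "Z \<subseteq> D" "pd_form V (sample_form Z (\<lambda>z. z))"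
proof -
  obtain B where B: "B \<subseteq> V" "cfun.independent B" "V \<subseteq> cfun.span B" "card B = d"
    using cfun.basis_exists[of V] assms(3) by metis
  have fin: "finite B" using B(4) assms(4) by (intro card_ge_0_finite) simp
  from unisolvent_points_span[OF fin B(1) assms(1,2)]
  obtain Z where Z: "finite Z" "Z \<subseteq> D" "\<forall>g\<in>cfun.span B. (\<forall>z\<in>Z. g z = 0) \<longrightarrow> g = 0"
    by (elim exE conjE)
  have "pd_form V (sample_form Z (\<lambda>z. z))"
  proof (rule pd_sample_form[OF Z(1) assms(1)])
    fix g assume "g \<in> V" "\<And>z. z \<in> Z \<Longrightarrow> g z = 0"
    then show "g = 0" by (intro Z(3)[rule_format]) (use B(3) in auto)
  qed
  then show ?thesis by (rule that[OF Z(1,2)])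
qed

text \<open>
  Tychonoff's theorem for the topology of pointwise convergence.
\<close>
lemma compact_pointwise:
  fixes K :: "'i \<Rightarrow> 'b::topological_space set"
  assumes "\<And>i. compact (K i)"
  shows "compact {f. \<forall>i. f i \<in> K i}"
proof -
  have "{f. \<forall>i. f i \<in> K i} = PiE UNIV K"
    unfolding PiE_UNIV_domain Pi_def by (simp only: UNIV_I simp_thms)
  moreover have "compactin (product_topology (\<lambda>_. euclidean) UNIV) (PiE UNIV K)"
    by (rule iffD2[OF compactin_PiE], rule disjI2, simp only: compactin_euclidean_iff)
      (use assms in blast)
  ultimately show ?thesis by (simp only: euclidean_product_topology compactin_euclidean_iff)
qed

lemma continuous_on_eval2: "continuous_on UNIV (\<lambda>b :: 'i \<Rightarrow> 'a \<Rightarrow> complex. b i x)"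
  by (rule continuous_on_product_then_coordinatewise[of UNIV "\<lambda>b. b i" x]) simp

text \<open>
  The coefficients of \<open>f\<close> in an orthonormal basis for a discrete inner product are finite linear combinations of
  values of \<open>f\<close>. Hence membership in \<open>V\<close> is expressed by equations that are continuous in \<open>f\<close>.
\<close>
lemma closed_subspace_pointwise:
  assumes "cfun.subspace V" "V \<subseteq> supported_on D" "cfun.dim V = d" "d \<ge> 1"
  shows "closed V"
proof -
  obtain Z where Z: "finite Z" "Z \<subseteq> D" "pd_form V (sample_form Z (\<lambda>z. z))"
    using unisolvent_points[OF assms] by blast
  interpret S: pd_form V "sample_form Z (\<lambda>z. z)" by fact
  obtain u where u: "orthonormal_basis V (sample_form Z (\<lambda>z. z)) d u"
    using S.orthonormal_basis_exists assms by blast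
  have "V = {f. \<forall>x. f x = (\<Sum>j<d. sample_form Z (\<lambda>z. z) f (u j) * u j x)}" (is "_ = ?W")
  proof (intro equalityI subsetI)
    fix f assume "f \<in> V"
    then have "f = lincomb d (\<lambda>j. sample_form Z (\<lambda>z. z) f (u j)) u"
      using u by (simp add: orthonormal_basis_def)
    then have "f x = lincomb d (\<lambda>j. sample_form Z (\<lambda>z. z) f (u j)) u x" for x by (rule fun_cong)
    then show "f \<in> ?W" unfolding lincomb_def mem_Collect_eq by (rule allI)
  next
    fix f assume "f \<in> ?W"
    then have "f = lincomb d (\<lambda>j. sample_form Z (\<lambda>z. z) f (u j)) u"
      unfolding lincomb_def mem_Collect_eq by (intro ext) (erule spec)
    also have "\<dots> \<in> V" using u by (intro S.V_lincomb) (simp add: orthonormal_basis_def)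
    finally show "f \<in> V" .
  qed
  also have "closed ?W" unfolding sample_form_def
    by (intro closed_Collect_all closed_Collect_eq continuous_intros continuous_on_product_coordinates)
  finally show ?thesis .
qed

text \<open>
  The elements of \<open>V\<close> within distance \<open>\<sigma> + 1 / Suc n\<close> of \<open>f\<close> form a decreasing sequence of nonempty sets, where \<open>\<sigma>\<close>
  is the infimum of the distances. They are closed for pointwise convergence and bounded at every point,
  hence compact, and have a common element. Unbounded elements of \<open>V\<close> are at distance \<open>\<infinity>\<close>.
\<close>
lemma best_approximation_exists:
  assumes V: "cfun.subspace V" "V \<subseteq> supported_on (space M)"
      "cfun.dim V = d" "d \<ge> 1"
    and f: "f \<in> bounded_funs (space M)"
  obtains g where "is_arg_min (\<lambda>h. fun_norm M \<infinity> (f - h)) (\<lambda>h. h \<in> V) g"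
    and "fun_norm M \<infinity> (f - g) < \<infinity>"
proof -
  define N where "N = (\<lambda>h. fun_norm M \<infinity> (f - h))"
  have N_le: "N h \<le> ennreal s \<longleftrightarrow> (\<forall>x\<in>space M. cmod (f x - h x) \<le> s)" if "s \<ge> 0" for h s
    using that by (simp add: N_def fun_norm_def SUP_le_iff ennreal_le_iff)
  obtain B where B: "\<And>x. x \<in> space M \<Longrightarrow> cmod (f x) \<le> B"
    using f unfolding bounded_funs_def bounded_iff by auto
  define s0 where "s0 = (INF h\<in>V. N h)"
  have "s0 \<le> N 0" unfolding s0_def using cfun.subspace_0[OF V(1)] by (rule INF_lower)
  also have "N 0 \<le> ennreal (max 0 B)" using B by (subst N_le) (auto simp: max.coboundedI2)
  finally have s0_fin: "s0 < \<infinity>" by (rule le_less_trans) simp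
  define \<sigma> where "\<sigma> = enn2real s0"
  have \<sigma>: "\<sigma> \<ge> 0" "s0 = ennreal \<sigma>" using s0_fin by (simp_all add: \<sigma>_def)
  define F where "F = (\<lambda>n::nat. {g. \<forall>x\<in>space M. cmod (f x - g x) \<le> \<sigma> + 1 / real (Suc n)})"
  \<comment> \<open>A compact box that contains all candidates, because \<open>1 / Suc n \<le> 1\<close>.\<close>
  define K where "K = {g :: 'a \<Rightarrow> complex. \<forall>x. g x \<in> (if x \<in> space M then cball 0 (cmod (f x) + \<sigma> + 1) else {0})}"
  have F_closed: "closed (F n)" for n
  proof -
    have "F n = (\<Inter>x\<in>space M. {g. cmod (f x - g x) \<le> \<sigma> + 1 / real (Suc n)})" by (auto simp: F_def)
    also have "closed \<dots>"
      by (intro closed_INT ballI closed_Collect_le continuous_intros continuous_on_product_coordinates)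
    finally show ?thesis .
  qed
  have F_ne: "\<exists>g\<in>V. g \<in> F n" for n
  proof -
    have "s0 < ennreal (\<sigma> + 1 / real (Suc n))" using \<sigma> by (simp add: ennreal_lessI)
    then obtain g where "g \<in> V" "N g < ennreal (\<sigma> + 1 / real (Suc n))"
      unfolding s0_def INF_less_iff by blast
    moreover have "0 \<le> \<sigma> + 1 / real (Suc n)" using \<sigma> by simp
    ultimately show ?thesis using N_le[of "\<sigma> + 1 / real (Suc n)" g] by (auto simp: F_def)
  qed
  have F_mono: "F n \<subseteq> F m" if "m \<le> n" for m n
  proof -
    have "1 / real (Suc n) \<le> 1 / real (Suc m)" using that by (intro divide_left_mono) auto
    then show ?thesis unfolding F_def by (smt (verit) Collect_mono)
  qed
  have F_K: "V \<inter> F n \<subseteq> K" for n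
  proof
    fix g assume g: "g \<in> V \<inter> F n"
    have "cmod (g x) \<le> cmod (f x) + \<sigma> + 1" if "x \<in> space M" for x
    proof -
      have "cmod (f x - g x) \<le> \<sigma> + 1 / real (Suc n)" using g that by (auto simp: F_def)
      also have "\<dots> \<le> \<sigma> + 1" by (simp add: field_simps)
      finally show ?thesis using norm_triangle_ineq3[of "f x" "g x"] by linarith
    qed
    then show "g \<in> K" using g supported_onD[OF V(2)] by (auto simp: K_def)
  qed
  have "compact K" unfolding K_def by (rule compact_pointwise) auto
  then have "compact (K \<inter> V)" using closed_subspace_pointwise[OF V] by (rule compact_Int_closed)
  then have "K \<inter> V \<inter> (\<Inter>n. F n) \<noteq> {}"
  proof (rule compact_imp_fip_image)
    fix I :: "nat set" assume "finite I"
    then obtain n where n: "\<And>i. i \<in> I \<Longrightarrow> i \<le> n" unfolding finite_nat_set_iff_bounded_le by auto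
    obtain g where g: "g \<in> V" "g \<in> F n" using F_ne[of n] by auto
    have "g \<in> K" using F_K[of n] g by auto
    moreover have "g \<in> F i" if "i \<in> I" for i using F_mono[OF n[OF that]] g(2) by (rule subsetD)
    ultimately show "K \<inter> V \<inter> (\<Inter>i\<in>I. F i) \<noteq> {}" using g(1) by (intro ex_in_conv[THEN iffD1] exI[of _ g]) simp
  qed (rule F_closed)
  then obtain g where "g \<in> K \<inter> V \<inter> (\<Inter>n. F n)" by (meson ex_in_conv)
  then have gV: "g \<in> V" and g: "g \<in> F n" for n by auto
  have "cmod (f x - g x) \<le> \<sigma>" if "x \<in> space M" for x
  proof (rule field_le_epsilon)
    fix e :: real assume "e > 0"
    then obtain n where "1 / real (Suc n) < e" using nat_approx_posE by blast
    moreover have "cmod (f x - g x) \<le> \<sigma> + 1 / real (Suc n)" using g[of n] that by (auto simp: F_def)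
    ultimately show "cmod (f x - g x) \<le> \<sigma> + e" by simp
  qed
  then have "N g \<le> s0" using N_le[OF \<sigma>(1)] \<sigma>(2) by simp
  moreover have "s0 \<le> N h" if "h \<in> V" for h unfolding s0_def using that by (rule INF_lower)
  ultimately have "is_arg_min N (\<lambda>h. h \<in> V) g"
    unfolding is_arg_min_linorder using gV by (meson order_trans)
  moreover have "N g < \<infinity>" using \<open>N g \<le> s0\<close> s0_fin by (rule le_less_trans)
  ultimately show ?thesis unfolding N_def by (rule that)
qed

section \<open>Triangular bases\<close>

text \<open>
  As many functions as the dimension that span \<open>V\<close> form a basis, and the sum of the products of the
  coordinates in a basis is an inner product that makes it orthonormal.
\<close>
lemma orthonormalizing_form:
  assumes V: "cfun.subspace V" "cfun.dim V = d" "d \<ge> 1"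
    and bV: "\<And>i. i < d \<Longrightarrow> b i \<in> V" and sp: "V \<subseteq> cfun.span (b ` {..<d})"
  obtains G where "pd_form V G" "orthonormal_basis V G d b"
proof -
  define B where "B = b ` {..<d}"
  have fin: "finite B" by (simp add: B_def)
  have "d \<le> card B" using cfun.dim_le_card[of V B] sp V(2) fin by (simp add: B_def)
  moreover have "card B \<le> d" unfolding B_def using card_image_le[of "{..<d}" b] by simp
  ultimately have card: "card B = d" by simp
  have inj: "inj_on b {..<d}" by (rule eq_card_imp_inj_on) (use card in \<open>auto simp: B_def\<close>)
  have BV: "B \<subseteq> V" using bV by (auto simp: B_def)
  have span: "cfun.span B = V" using sp cfun.span_minimal[OF BV V(1)] by (auto simp: B_def)
  have indep: "cfun.independent B"
  proof
    assume "cfun.dependent B"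
    then obtain a where a: "a \<in> B" "a \<in> cfun.span (B - {a})" unfolding cfun.dependent_def by blast
    then have "cfun.span (B - {a}) = V"
      using cfun.span_redundant[of a "B - {a}"] span by (simp add: insert_absorb)
    then have "d \<le> card (B - {a})" using cfun.dim_le_card[of V "B - {a}"] V(2) fin by simp
    then show False using a(1) card fin V(3) by (simp add: card_Diff_singleton)
  qed
  define r where "r = cfun.representation B"
  have r_add: "r (f + g) v = r f v + r g v" if "f \<in> V" "g \<in> V" for f g v
    using cfun.representation_add[OF indep, of g f] that span by (simp add: r_def)
  have r_smult: "r (smult c f) v = c * r f v" if "f \<in> V" for c f v
    using cfun.representation_scale[OF indep, of f c] that span by (simp add: r_def smult_def)
  have r_b: "r (b j) (b i) = (if i = j then 1 else 0)" if "i < d" "j < d" for i j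
  proof -
    have "b j \<in> B" using that by (simp add: B_def)
    from cfun.representation_basis[OF indep this]
    show ?thesis using inj_onD[OF inj, of i j] that by (auto simp: r_def)
  qed
  have expand: "f = lincomb d (\<lambda>i. r f (b i)) b" if "f \<in> V" for f
  proof -
    have "(\<Sum>v\<in>B. (\<lambda>x. r f v * v x)) = f"
      unfolding r_def by (rule cfun.sum_representation_eq[OF indep]) (use that span fin in auto)
    moreover have "(\<Sum>v\<in>B. (\<lambda>x. r f v * v x)) = (\<Sum>i<d. (\<lambda>x. r f (b i) * b i x))"
      unfolding B_def by (rule sum.reindex_cong[OF inj refl refl])
    moreover have "(\<Sum>i<k. (\<lambda>x. r f (b i) * b i x)) = lincomb k (\<lambda>i. r f (b i)) b" for k
      by (induction k) (simp_all add: lincomb_0 lincomb_Suc smult_def)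
    ultimately show ?thesis by simp
  qed
  define G where "G = (\<lambda>f g. \<Sum>i<d. r f (b i) * cnj (r g (b i)))"
  have form: "pd_form V G"
  proof
    show "cfun.subspace V" by fact
    fix f assume f: "f \<in> V" "f \<noteq> 0"
    have "\<exists>i<d. r f (b i) \<noteq> 0"
    proof (rule ccontr)
      assume "\<not> (\<exists>i<d. r f (b i) \<noteq> 0)"
      then have "lincomb d (\<lambda>i. r f (b i)) b x = 0" for x by (simp add: lincomb_def)
      then have "f x = 0" for x using expand[OF f(1)] by metis
      then show False using f(2) by (auto simp: fun_eq_iff)
    qed
    then obtain i where i: "i < d" "r f (b i) \<noteq> 0" by blast
    have "G f f = of_real (\<Sum>i<d. (cmod (r f (b i)))\<^sup>2)"
      unfolding G_def of_real_sum complex_norm_square ..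
    moreover have "(\<Sum>i<d. (cmod (r f (b i)))\<^sup>2) > 0"
      by (rule sum_pos2[of _ i]) (use i in auto)
    ultimately show "0 < Re (G f f)" by simp
  qed (auto simp: G_def r_add r_smult sum.distrib sum_distrib_left algebra_simps)
  have Gb: "G f (b j) = r f (b j)" if "j < d" for f j
  proof -
    have "G f (b j) = (\<Sum>i<d. if i = j then r f (b j) else 0)"
      unfolding G_def by (intro sum.cong refl) (use r_b that in auto)
    then show ?thesis using that by simp
  qed
  have "orthonormal_basis V G d b"
    unfolding orthonormal_basis_def
  proof (intro conjI ballI allI impI)
    fix g assume g: "g \<in> V"
    have "lincomb d (\<lambda>i. G g (b i)) b = lincomb d (\<lambda>i. r g (b i)) b"
      by (simp add: lincomb_def Gb fun_eq_iff)
    then show "g = lincomb d (\<lambda>i. G g (b i)) b" using expand[OF g] by metis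
  qed (use bV Gb r_b in auto)
  with form that show ?thesis by blast
qed

text \<open>
  The derivative of the product at \<open>t = 0\<close> is the sum of the \<open>a i\<close>.
\<close>
lemma prod_one_plus_gt_1:
  fixes a :: "'i \<Rightarrow> real"
  assumes "(\<Sum>i\<in>I. a i) > 0"
  shows "\<exists>t0>0. \<forall>t. 0 < t \<longrightarrow> t < t0 \<longrightarrow> (\<Prod>i\<in>I. 1 + t * a i) > 1"
proof -
  define F where "F = (\<lambda>t. \<Prod>i\<in>I. 1 + t * a i)"
  have "finite I" using assms by (rule contrapos_pp) simp
  have "(F has_field_derivative (\<Sum>i\<in>I. a i * (\<Prod>j\<in>I - {i}. 1 + 0 * a j))) (at 0)"
    unfolding F_def by (rule has_field_derivative_prod) (auto intro!: derivative_eq_intros)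
  then have "(F has_field_derivative (\<Sum>i\<in>I. a i)) (at 0)" by simp
  from DERIV_pos_inc_right[OF this assms]
  show ?thesis by (auto simp: F_def)
qed

lemma bounded_sum_squares:
  fixes f :: "nat \<Rightarrow> 'a \<Rightarrow> complex"
  assumes "\<And>i. i < d \<Longrightarrow> f i \<in> bounded_funs D"
  obtains C where "C \<ge> 0" "\<And>x. x \<in> D \<Longrightarrow> (\<Sum>i<d. (cmod (f i x))\<^sup>2) \<le> C"
proof -
  have "\<exists>B. \<forall>x\<in>D. cmod (f i x) \<le> B" if "i < d" for i
    using assms[OF that] unfolding bounded_funs_def bounded_iff by auto
  then obtain B where B: "\<And>i x. i < d \<Longrightarrow> x \<in> D \<Longrightarrow> cmod (f i x) \<le> B i" by metis
  show ?thesis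
  proof (rule that[of "\<Sum>i<d. (B i)\<^sup>2"])
    show "(\<Sum>i<d. (cmod (f i x))\<^sup>2) \<le> (\<Sum>i<d. (B i)\<^sup>2)" if "x \<in> D" for x
      using B that by (intro sum_mono power_mono) auto
  qed (intro sum_nonneg, auto)
qed

text \<open>
  A Hermitian form is the real part of a sum over the lower triangle, with the off-diagonal entries
  doubled. So variations by triangular matrices reach every Hermitian form.
\<close>
lemma hermitian_sum_lower:
  fixes H :: "nat \<Rightarrow> nat \<Rightarrow> complex"
  assumes "\<And>i j. H j i = cnj (H i j)"
  shows "Re (\<Sum>i<d. \<Sum>j<d. H i j * v i * cnj (v j)) =
    Re (\<Sum>i<d. (H i i * v i + (\<Sum>j<i. 2 * H j i * v j)) * cnj (v i))"
proof (induction d)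
  case (Suc d)
  have swap: "Re (H d j * v d * cnj (v j)) = Re (H j d * v j * cnj (v d))" for j
  proof -
    have "H d j * v d * cnj (v j) = cnj (H j d * v j * cnj (v d))" using assms[of d j] by simp
    then show ?thesis by (simp only: cnj.sel)
  qed
  have "Re (\<Sum>i<Suc d. \<Sum>j<Suc d. H i j * v i * cnj (v j)) =
      Re (\<Sum>i<d. \<Sum>j<d. H i j * v i * cnj (v j)) + (\<Sum>i<d. Re (H i d * v i * cnj (v d)))
      + (\<Sum>j<d. Re (H d j * v d * cnj (v j))) + Re (H d d * v d * cnj (v d))"
    by (simp add: sum.distrib)
  also have "(\<Sum>j<d. Re (H d j * v d * cnj (v j))) = (\<Sum>j<d. Re (H j d * v j * cnj (v d)))"
    by (simp only: swap)
  also have "Re (\<Sum>i<d. \<Sum>j<d. H i j * v i * cnj (v j)) + (\<Sum>i<d. Re (H i d * v i * cnj (v d)))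
      + (\<Sum>j<d. Re (H j d * v j * cnj (v d))) + Re (H d d * v d * cnj (v d))
    = Re (\<Sum>i<d. \<Sum>j<d. H i j * v i * cnj (v j))
      + Re ((H d d * v d + (\<Sum>j<d. 2 * H j d * v j)) * cnj (v d))"
  proof -
    have "Re ((\<Sum>j<d. 2 * H j d * v j) * cnj (v d)) = 2 * (\<Sum>j<d. Re (H j d * v j * cnj (v d)))"
    proof -
      have Re2: "Re (2 * z) = 2 * Re z" for z by simp
      show ?thesis unfolding sum_distrib_left sum_distrib_right Re_sum
        by (intro sum.cong refl) (simp only: mult.assoc Re2)
    qed
    then show ?thesis by (simp only: distrib_right plus_complex.sel)
  qed
  finally show ?case using Suc.IH by (simp only: sum.lessThan_Suc plus_complex.sel)
qed simp

text \<open>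
  Candidates for the extremal orthonormal basis. The basis change from \<open>u\<close> is triangular, so that its
  determinant is the product of the \<open>S (b i) (u i)\<close>. The entries from \<open>d\<close> on are fixed to make the set
  compact.
\<close>
definition triangular_design ::
  "'a set \<Rightarrow> ('a \<Rightarrow> complex) set \<Rightarrow> (('a \<Rightarrow> complex) \<Rightarrow> ('a \<Rightarrow> complex) \<Rightarrow> complex) \<Rightarrow> nat \<Rightarrow>
    (nat \<Rightarrow> 'a \<Rightarrow> complex) \<Rightarrow> (nat \<Rightarrow> 'a \<Rightarrow> complex) set" where
  "triangular_design D V S d u = {b. (\<forall>i<d. b i \<in> V) \<and> (\<forall>i<d. \<forall>j<d. i < j \<longrightarrow> S (b i) (u j) = 0) \<and>
     (\<forall>i\<ge>d. b i = 0) \<and> (\<forall>x\<in>D. (\<Sum>i<d. (cmod (b i x))\<^sup>2) \<le> d)}"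

lemma compact_triangular_design:
  assumes V: "cfun.subspace V" "V \<subseteq> supported_on D" "cfun.dim V = d" "d \<ge> 1"
    and Z: "finite Z"
  shows "compact (triangular_design D V (sample_form Z (\<lambda>z. z)) d u)"
proof -
  define K where "K = {b :: nat \<Rightarrow> 'a \<Rightarrow> complex. \<forall>i. b i \<in> {f. \<forall>x. f x \<in> cball 0 (sqrt d)}}"
  have "compact K" unfolding K_def by (intro compact_pointwise) auto
  have cl1: "closed {b :: nat \<Rightarrow> 'a \<Rightarrow> complex. b i \<in> V}" for i
  proof -
    have "continuous_on UNIV (\<lambda>b :: nat \<Rightarrow> 'a \<Rightarrow> complex. b i)" by simp
    then have "closed ((\<lambda>b :: nat \<Rightarrow> 'a \<Rightarrow> complex. b i) -` V \<inter> UNIV)"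
      using continuous_on_closed_vimage[OF closed_UNIV] closed_subspace_pointwise[OF V] by blast
    then show ?thesis by (simp add: vimage_def)
  qed
  have cl2: "closed {b :: nat \<Rightarrow> 'a \<Rightarrow> complex. b i = 0}" for i
  proof -
    have "closed {b :: nat \<Rightarrow> 'a \<Rightarrow> complex. \<forall>x. b i x = 0}"
      by (intro closed_Collect_all closed_Collect_eq continuous_on_eval2 continuous_on_const)
    then show ?thesis by (simp add: fun_eq_iff)
  qed
  have "triangular_design D V (sample_form Z (\<lambda>z. z)) d u =
      (\<Inter>i\<in>{..<d}. {b. b i \<in> V}) \<inter>
      (\<Inter>i\<in>{..<d}. \<Inter>j\<in>{i<..<d}. {b. sample_form Z (\<lambda>z. z) (b i) (u j) = 0}) \<inter>
      (\<Inter>i\<in>{d..}. {b. b i = 0}) \<inter> (\<Inter>x\<in>D. {b. (\<Sum>i<d. (cmod (b i x))\<^sup>2) \<le> d})"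
    unfolding triangular_design_def by fastforce
  also have "closed \<dots>" unfolding sample_form_def
    by (intro closed_Int closed_INT ballI cl1 cl2 closed_Collect_eq closed_Collect_le
        continuous_intros continuous_on_eval2)
  finally have "closed (triangular_design D V (sample_form Z (\<lambda>z. z)) d u)" .
  moreover have "triangular_design D V (sample_form Z (\<lambda>z. z)) d u \<subseteq> K"
  proof
    fix b assume b: "b \<in> triangular_design D V (sample_form Z (\<lambda>z. z)) d u"
    have "cmod (b i x) \<le> sqrt d" for i x
    proof (cases "i < d \<and> x \<in> D")
      case True
      then have "(cmod (b i x))\<^sup>2 \<le> (\<Sum>i<d. (cmod (b i x))\<^sup>2)" by (intro member_le_sum) auto
      also have "\<dots> \<le> d" using b True by (auto simp: triangular_design_def)
      finally show ?thesis by (rule real_le_rsqrt)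
    next
      case False
      have "b i x = 0"
      proof (cases "i < d")
        case True
        then show ?thesis using False b supported_onD[OF V(2), of "b i" x]
          by (auto simp: triangular_design_def)
      next
        case False
        then show ?thesis using b by (auto simp: triangular_design_def)
      qed
      then show ?thesis by simp
    qed
    then show "b \<in> K" by (simp add: K_def)
  qed
  ultimately show ?thesis using \<open>compact K\<close> by (metis compact_Int_closed inf.absorb_iff2)
qed

section \<open>An extremal inner product for the sup norm\<close>

lemma cmod_add_smult_square:
  "(cmod (z + of_real t * w))\<^sup>2 = (cmod z)\<^sup>2 + 2 * t * Re (w * cnj z) + t\<^sup>2 * (cmod w)\<^sup>2"
  unfolding cmod_power2 by (simp add: power2_eq_square algebra_simps)

text \<open>
  The diagonal entries of the triangular system are nonzero, so it can be solved by forward substitution.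
\<close>
lemma triangular_spans:
  assumes "pd_form V S" and u: "orthonormal_basis V S d u"
    and bV: "\<And>i. i < d \<Longrightarrow> b i \<in> V"
    and tri: "\<And>i j. i < j \<Longrightarrow> j < d \<Longrightarrow> S (b i) (u j) = 0"
    and diag: "\<And>i. i < d \<Longrightarrow> S (b i) (u i) \<noteq> 0"
  shows "V \<subseteq> cfun.span (b ` {..<d})"
proof -
  interpret S: pd_form V S by fact
  have u_span: "u i \<in> cfun.span (b ` {..<d})" if "i < d" for i
    using that
  proof (induction i rule: less_induct)
    case (less i)
    define c where "c = (\<lambda>j. S (b i) (u j))"
    have "b i = lincomb (Suc i) c u"
    proof (rule ext)
      fix x
      have "b i x = lincomb d c u x"
        using u bV[OF less.prems] unfolding orthonormal_basis_def c_def by metis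
      also have "\<dots> = lincomb (Suc i) c u x" unfolding lincomb_def
        by (rule sum.mono_neutral_right) (use less.prems tri in \<open>auto simp: c_def\<close>)
      finally show "b i x = lincomb (Suc i) c u x" .
    qed
    then have bi: "b i = lincomb i c u + smult (c i) (u i)" unfolding lincomb_Suc .
    have ui: "u i = smult (1 / c i) (b i - lincomb i c u)"
      unfolding bi using diag[OF less.prems] by (simp add: fun_eq_iff c_def)
    have "lincomb i c u \<in> cfun.span (b ` {..<d})"
      using less.IH less.prems by (intro lincomb_in_subspace cfun.subspace_span) auto
    moreover have "b i \<in> cfun.span (b ` {..<d})" using less.prems by (intro cfun.span_base) auto
    ultimately show ?case by (subst ui) (intro subspace_smult cfun.subspace_span cfun.span_diff)
  qed
  show ?thesis
  proof
    fix g assume "g \<in> V"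
    then have "g = lincomb d (\<lambda>i. S g (u i)) u" using u by (simp add: orthonormal_basis_def)
    also have "\<dots> \<in> cfun.span (b ` {..<d})"
      by (intro lincomb_in_subspace cfun.subspace_span u_span)
    finally show "g \<in> cfun.span (b ` {..<d})" .
  qed
qed

text \<open>
  \<open>\<Sum>i<d. (cmod (b i x))\<^sup>2\<close> is the square of the norm of evaluation at \<open>x\<close>.
\<close>
lemma (in pd_form) pointwise_bound:
  assumes b: "orthonormal_basis V G d b" and g: "g \<in> V"
  shows "(cmod (g x))\<^sup>2 \<le> (\<Sum>i<d. (cmod (b i x))\<^sup>2) * Re (G g g)"
proof -
  have "g x = lincomb d (\<lambda>i. G g (b i)) b x" using b g unfolding orthonormal_basis_def by metis
  then have "cmod (g x) = cmod (\<Sum>i<d. G g (b i) * b i x)" by (simp only: lincomb_def)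
  also have "\<dots> \<le> (\<Sum>i<d. cmod (G g (b i)) * cmod (b i x))"
    by (rule order_trans[OF norm_sum]) (simp add: norm_mult)
  finally have "(cmod (g x))\<^sup>2 \<le> (\<Sum>i<d. cmod (G g (b i)) * cmod (b i x))\<^sup>2"
    by (intro power_mono) auto
  also have "\<dots> \<le> (\<Sum>i<d. (cmod (G g (b i)))\<^sup>2) * (\<Sum>i<d. (cmod (b i x))\<^sup>2)"
    by (rule Cauchy_Schwarz_ineq_sum)
  finally show ?thesis using Parseval_norm[OF b g] by (simp add: mult.commute)
qed

text \<open>
  The determinant is a continuous function of finitely many values, and the set of candidates is compact. A small
  multiple of \<open>u\<close> is a candidate with positive determinant.
\<close>
lemma triangular_design_maximizer:
  assumes V: "cfun.subspace V" "V \<subseteq> bounded_funs D" "cfun.dim V = d" "d \<ge> 1"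
    and Z: "finite Z" "pd_form V (sample_form Z (\<lambda>z. z))"
    and u: "orthonormal_basis V (sample_form Z (\<lambda>z. z)) d u"
  defines "S \<equiv> sample_form Z (\<lambda>z. z)"
  obtains b where "b \<in> triangular_design D V S d u"
    and "0 < (\<Prod>i<d. cmod (S (b i) (u i)))"
    and "\<And>b'. b' \<in> triangular_design D V S d u \<Longrightarrow>
      (\<Prod>i<d. cmod (S (b' i) (u i))) \<le> (\<Prod>i<d. cmod (S (b i) (u i)))"
proof -
  interpret S: pd_form V S unfolding S_def by fact
  note u = u[folded S_def]
  have sup: "V \<subseteq> supported_on D" using V(2) by (auto simp: bounded_funs_def supported_on_def)
  have uV: "\<And>i. i < d \<Longrightarrow> u i \<in> V" and ortho: "\<And>i j. i < d \<Longrightarrow> j < d \<Longrightarrow> S (u i) (u j) = (if i = j then 1 else 0)"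
    using u by (simp_all add: orthonormal_basis_def)
  define K where "K = triangular_design D V S d u"
  have "compact K" unfolding K_def S_def
    by (rule compact_triangular_design) (use V sup Z in auto)
  obtain C where C: "C \<ge> 0" "\<And>x. x \<in> D \<Longrightarrow> (\<Sum>i<d. (cmod (u i x))\<^sup>2) \<le> C"
    by (rule bounded_sum_squares[of d u D]) (use uV V(2) in auto)
  define t where "t = sqrt (d / (C + 1))"
  have t: "t > 0" using V(4) C(1) by (simp add: t_def)
  define b0 where "b0 = (\<lambda>i. if i < d then smult (of_real t) (u i) else 0)"
  have Sb0: "S (b0 i) (u j) = (if i = j then of_real t else 0)" if "i < d" "j < d" for i j
    using that ortho uV by (simp add: b0_def S.scale)
  have b0: "b0 \<in> K"
  proof -
    have "(\<Sum>i<d. (cmod (b0 i x))\<^sup>2) \<le> d" if "x \<in> D" for x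
    proof -
      have "(\<Sum>i<d. (cmod (b0 i x))\<^sup>2) = t\<^sup>2 * (\<Sum>i<d. (cmod (u i x))\<^sup>2)"
        by (simp add: b0_def norm_mult power_mult_distrib sum_distrib_left)
      also have "\<dots> \<le> t\<^sup>2 * (C + 1)" using C(2)[OF that] by (intro mult_left_mono) auto
      also have "\<dots> = d" using C(1) by (simp add: t_def)
      finally show ?thesis .
    qed
    moreover have "b0 i \<in> V" if "i < d" for i using that uV by (simp add: b0_def S.V_scale)
    moreover have "b0 i = 0" if "i \<ge> d" for i using that by (simp add: b0_def)
    ultimately show ?thesis using Sb0 by (simp add: K_def triangular_design_def)
  qed
  define F where "F = (\<lambda>b :: nat \<Rightarrow> 'a \<Rightarrow> complex. \<Prod>i<d. cmod (S (b i) (u i)))"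
  have "continuous_on UNIV F" unfolding F_def S_def sample_form_def
    by (intro continuous_intros continuous_on_eval2)
  then have "continuous_on K F" by (rule continuous_on_subset) simp
  then obtain b where b: "b \<in> K" "\<And>b'. b' \<in> K \<Longrightarrow> F b' \<le> F b"
    using continuous_attains_sup[OF \<open>compact K\<close>, of F] b0 by (metis empty_iff)
  have "0 < t ^ d" using t by simp
  also have "t ^ d = F b0" using t by (simp add: F_def Sb0)
  also have "\<dots> \<le> F b" by (rule b(2)[OF b0])
  finally have "0 < F b" .
  from that[of b] this b show ?thesis unfolding F_def K_def by blast
qed

text \<open>
  Isotropy is the first-order optimality condition of the determinant maximization. Suppose that it fails, so that
  the weighted sum \<open>q x = \<Sum>i<N. w i * (cmod (h i x))\<^sup>2\<close> is at most \<open>\<tau> - \<eta>\<close> on all of \<open>D\<close>, where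
  \<open>\<tau>\<close> is the trace of its Hermitian matrix \<open>H\<close> in the basis \<open>b\<close>. Vary \<open>b\<close> in the triangular direction that
  corresponds to \<open>H\<close> minus a multiple of the identity, where the multiple is chosen such that the trace \<open>\<eta> / 2\<close> remains. The
  determinant grows because this trace is positive. To first order, \<open>\<Sum>i<d. (cmod (b i x))\<^sup>2\<close> decreases at points
  where it is close to its bound \<open>d\<close>, because \<open>q x < \<tau> - \<eta> / 2\<close> there; at the other points there
  is room. So the varied basis is a candidate, in contradiction to maximality.
\<close>
theorem uniform_design:
  fixes V :: "('a \<Rightarrow> complex) set"
  assumes V: "cfun.subspace V" "V \<subseteq> bounded_funs D" "cfun.dim V = d" "d \<ge> 1"
  obtains G where "pd_form V G" "isotropic D V G"
    and "\<And>g x. g \<in> V \<Longrightarrow> x \<in> D \<Longrightarrow> (cmod (g x))\<^sup>2 \<le> d * Re (G g g)"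
proof -
  have sup: "V \<subseteq> supported_on D" using V(2) by (auto simp: bounded_funs_def supported_on_def)
  obtain Z where Z: "finite Z" "Z \<subseteq> D" "pd_form V (sample_form Z (\<lambda>z. z))"
    using unisolvent_points[OF V(1) sup V(3,4)] by blast
  define S where "S = (sample_form Z (\<lambda>z. z) :: ('a \<Rightarrow> complex) \<Rightarrow> _)"
  interpret S: pd_form V S unfolding S_def by fact
  obtain u where u: "orthonormal_basis V S d u" using S.orthonormal_basis_exists V by blast
  have uV: "\<And>i. i < d \<Longrightarrow> u i \<in> V" using u by (simp add: orthonormal_basis_def)
  obtain b where b: "b \<in> triangular_design D V S d u"
    and F_pos: "0 < (\<Prod>i<d. cmod (S (b i) (u i)))"
    and max: "\<And>b'. b' \<in> triangular_design D V S d u \<Longrightarrow>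
      (\<Prod>i<d. cmod (S (b' i) (u i))) \<le> (\<Prod>i<d. cmod (S (b i) (u i)))"
    using triangular_design_maximizer[OF V Z(1,3) u[unfolded S_def]] unfolding S_def by blast
  have bV: "\<And>i. i < d \<Longrightarrow> b i \<in> V"
    and tri: "\<And>i j. i < j \<Longrightarrow> j < d \<Longrightarrow> S (b i) (u j) = 0"
    and size: "\<And>x. x \<in> D \<Longrightarrow> (\<Sum>i<d. (cmod (b i x))\<^sup>2) \<le> d"
    using b unfolding triangular_design_def by auto
  have diag: "S (b i) (u i) \<noteq> 0" if "i < d" for i
  proof
    assume "S (b i) (u i) = 0"
    then have "(\<Prod>i<d. cmod (S (b i) (u i))) = 0" using that by (intro prod_zero) auto
    with F_pos show False by simp
  qed
  have span: "V \<subseteq> cfun.span (b ` {..<d})"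
    by (rule triangular_spans[where b = b, OF S.pd_form_axioms u bV tri diag])
  obtain G where G: "pd_form V G" "orthonormal_basis V G d b"
    by (rule orthonormalizing_form[where b = b, OF V(1,3,4)]) (rule bV span | assumption)+
  interpret G: pd_form V G by fact
  have bound: "(cmod (g x))\<^sup>2 \<le> d * Re (G g g)" if "g \<in> V" "x \<in> D" for g x
    using G.pointwise_bound[OF G(2) that(1), of x]
      mult_right_mono[OF size[OF that(2)] G.nonneg[OF that(1)]] by linarith
  have "isotropic D V G"
    unfolding isotropic_def
  proof (intro allI impI)
    fix N :: nat and w :: "nat \<Rightarrow> real" and h :: "nat \<Rightarrow> 'a \<Rightarrow> complex" and \<eta> :: real
    assume hV: "\<forall>i<N. h i \<in> V" and \<eta>: "\<eta> > 0"
    define \<tau> where "\<tau> = (\<Sum>i<N. w i * Re (G (h i) (h i)))"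
    define q where "q = (\<lambda>x. \<Sum>i<N. w i * (cmod (h i x))\<^sup>2)"
    show "\<exists>x\<in>D. (\<Sum>i<N. w i * Re (G (h i) (h i))) - \<eta> < (\<Sum>i<N. w i * (cmod (h i x))\<^sup>2)"
    proof (rule ccontr)
      assume "\<not> ?thesis"
      then have q_le: "q x \<le> \<tau> - \<eta>" if "x \<in> D" for x
        using that unfolding q_def \<tau>_def by (meson not_less)
      define c where "c = (\<lambda>k i. G (h k) (b i))"
      define H where "H = (\<lambda>i j. \<Sum>k<N. of_real (w k) * c k i * cnj (c k j))"
      define Hr where "Hr = (\<lambda>i. \<Sum>k<N. w k * (cmod (c k i))\<^sup>2)"
      have H_herm: "H j i = cnj (H i j)" for i j by (simp add: H_def mult_ac)
      have H_diag: "H i i = of_real (Hr i)" for i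
        unfolding H_def Hr_def of_real_sum of_real_mult complex_norm_square by (simp add: mult.assoc)
      have trace: "(\<Sum>i<d. Hr i) = \<tau>"
      proof -
        have "(\<Sum>i<d. Hr i) = (\<Sum>k<N. \<Sum>i<d. w k * (cmod (c k i))\<^sup>2)"
          unfolding Hr_def by (rule sum.swap)
        also have "\<dots> = \<tau>" unfolding \<tau>_def sum_distrib_left[symmetric] c_def
          by (intro sum.cong refl) (use hV G.Parseval_norm[OF G(2)] in auto)
        finally show ?thesis .
      qed
      have quad: "q x = Re (\<Sum>i<d. \<Sum>j<d. H i j * b i x * cnj (b j x))" for x
      proof -
        have sq: "of_real (w k * (cmod (h k x))\<^sup>2) =
            (\<Sum>i<d. \<Sum>j<d. of_real (w k) * c k i * cnj (c k j) * b i x * cnj (b j x))"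
          if "k < N" for k
        proof -
          have "h k x = (\<Sum>i<d. c k i * b i x)"
            using G(2) hV that unfolding orthonormal_basis_def lincomb_def c_def by metis
          then have "h k x * cnj (h k x) = (\<Sum>i<d. \<Sum>j<d. (c k i * b i x) * cnj (c k j * b j x))"
            by (simp only: cnj_sum sum_product)
          then show ?thesis unfolding of_real_mult complex_norm_square
            by (simp add: sum_distrib_left mult_ac)
        qed
        have "of_real (q x) = (\<Sum>k<N. \<Sum>i<d. \<Sum>j<d. of_real (w k) * c k i * cnj (c k j) * b i x * cnj (b j x))"
          unfolding q_def of_real_sum by (intro sum.cong refl sq) simp
        also have "\<dots> = (\<Sum>i<d. \<Sum>k<N. \<Sum>j<d. of_real (w k) * c k i * cnj (c k j) * b i x * cnj (b j x))"
          by (rule sum.swap)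
        also have "\<dots> = (\<Sum>i<d. \<Sum>j<d. \<Sum>k<N. of_real (w k) * c k i * cnj (c k j) * b i x * cnj (b j x))"
          by (intro sum.cong refl sum.swap)
        also have "\<dots> = (\<Sum>i<d. \<Sum>j<d. H i j * b i x * cnj (b j x))"
          by (simp add: H_def sum_distrib_right)
        finally show ?thesis by (metis Re_complex_of_real)
      qed
      \<comment> \<open>The trace of \<open>H\<close> is lowered to \<open>\<kappa> * d = \<eta> / 2\<close>: still positive, but small compared with \<open>\<eta>\<close>.\<close>
      define \<kappa> where "\<kappa> = \<eta> / (2 * d)"
      define a where "a = (\<lambda>i. Hr i - (\<tau> / d - \<kappa>))"
      have a_sum: "(\<Sum>i<d. a i) = \<eta> / 2"
      proof -
        have "(\<Sum>i<d. a i) = (\<Sum>i<d. Hr i) - (\<Sum>i<d. \<tau> / d - \<kappa>)"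
          unfolding a_def by (rule sum_subtractf)
        also have "\<dots> = \<tau> - d * (\<tau> / d - \<kappa>)" by (simp only: trace sum_constant) simp
        also have "\<dots> = \<eta> / 2" using V(4) by (simp add: \<kappa>_def right_diff_distrib)
        finally show ?thesis .
      qed
      define p where "p = (\<lambda>i. lincomb i (\<lambda>j. 2 * H j i) b + smult (of_real (a i)) (b i))"
      have pV: "p i \<in> V" if "i < d" for i
        unfolding p_def using that bV by (intro G.V_intros) auto
      have cross: "(\<Sum>i<d. Re (p i x * cnj (b i x))) = q x - (\<tau> / d - \<kappa>) * (\<Sum>i<d. (cmod (b i x))\<^sup>2)" for x
      proof -
        have "Re (p i x * cnj (b i x)) = Re ((H i i * b i x + (\<Sum>j<i. 2 * H j i * b j x)) * cnj (b i x))
            - (\<tau> / d - \<kappa>) * (cmod (b i x))\<^sup>2" for i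
        proof -
          have "p i x * cnj (b i x) = (H i i * b i x + (\<Sum>j<i. 2 * H j i * b j x)) * cnj (b i x)
              - of_real (\<tau> / d - \<kappa>) * (b i x * cnj (b i x))"
            unfolding p_def a_def H_diag lincomb_def
            by (simp add: algebra_simps)
          then show ?thesis unfolding complex_norm_square[symmetric] by simp
        qed
        then have "(\<Sum>i<d. Re (p i x * cnj (b i x))) =
            Re (\<Sum>i<d. (H i i * b i x + (\<Sum>j<i. 2 * H j i * b j x)) * cnj (b i x))
            - (\<tau> / d - \<kappa>) * (\<Sum>i<d. (cmod (b i x))\<^sup>2)"
          unfolding Re_sum by (simp add: sum_subtractf sum_distrib_left)
        then show ?thesis unfolding quad hermitian_sum_lower[of H, OF H_herm] .
      qed
      obtain C where C: "C \<ge> 0" "\<And>x. x \<in> D \<Longrightarrow> (\<Sum>i<d. (cmod (p i x))\<^sup>2) \<le> C"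
        by (rule bounded_sum_squares[of d p D]) (use pV V(2) in auto)
      obtain t0 where t0: "t0 > 0" "\<And>t. 0 < t \<Longrightarrow> t < t0 \<Longrightarrow> (\<Prod>i<d. 1 + t * a i) > 1"
        using prod_one_plus_gt_1[where I = "{..<d}" and a = a] a_sum \<eta> by auto
      \<comment> \<open>The three bounds serve the growth of the determinant, the first-order term at points
        where the constraint is far from tight, and the second-order term.\<close>
      define t where "t = min (t0 / 2) (min (d / (2 * \<bar>\<tau>\<bar> + 1)) (\<eta> / (C + 1)))"
      have t: "t > 0" using t0(1) V(4) \<eta> C(1) by (simp add: t_def)
      have tt0: "t < t0" using t0(1) by (simp add: t_def)
      have t_\<tau>: "2 * t * \<bar>\<tau>\<bar> \<le> d"
      proof -
        have "t \<le> d / (2 * \<bar>\<tau>\<bar> + 1)" by (simp add: t_def)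
        then have "t * (2 * \<bar>\<tau>\<bar> + 1) \<le> d" by (simp add: pos_le_divide_eq)
        then show ?thesis using t by (simp add: algebra_simps)
      qed
      have t_C: "t * C \<le> \<eta>"
      proof -
        have "t \<le> \<eta> / (C + 1)" by (simp add: t_def)
        then have "t * (C + 1) \<le> \<eta>" using C(1) by (simp add: pos_le_divide_eq)
        then show ?thesis using t by (simp add: algebra_simps)
      qed
      define b' where "b' = (\<lambda>i. if i < d then b i + smult (of_real t) (p i) else 0)"
      have "b' \<in> triangular_design D V S d u"
        unfolding triangular_design_def
      proof (intro CollectI conjI allI impI ballI)
        show "b' i \<in> V" if "i < d" for i
          using that bV pV by (simp add: b'_def G.V_add G.V_scale)
        show "b' i = 0" if "d \<le> i" for i using that by (simp add: b'_def)
        fix i j assume ij: "i < d" "j < d" "i < j"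
        have "S (lincomb i (\<lambda>j. 2 * H j i) b) (u j) = (\<Sum>l<i. 2 * H l i * S (b l) (u j))"
          using ij bV uV by (intro S.lincomb_left) auto
        also have "\<dots> = 0" using ij tri by (intro sum.neutral) auto
        finally show "S (b' i) (u j) = 0"
          using ij bV uV tri pV[of i] by (simp add: b'_def p_def S.add S.scale S.V_intros)
      next
        fix x assume x: "x \<in> D"
        define n where "n = (\<Sum>i<d. (cmod (b i x))\<^sup>2)"
        have n: "n \<le> d" using size[OF x] by (simp add: n_def)
        have "(\<Sum>i<d. (cmod (b' i x))\<^sup>2) = n + 2 * t * (\<Sum>i<d. Re (p i x * cnj (b i x)))
            + t\<^sup>2 * (\<Sum>i<d. (cmod (p i x))\<^sup>2)"
          by (simp add: b'_def cmod_add_smult_square sum.distrib sum_distrib_left n_def del: times_complex.sel)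
        also have "\<dots> \<le> n + 2 * t * (\<tau> - \<eta> - (\<tau> / d - \<kappa>) * n) + t\<^sup>2 * C"
          unfolding cross n_def[symmetric] using q_le[OF x] C(2)[OF x] t
          by (intro add_mono mult_left_mono) auto
        also have "\<dots> \<le> d"
        proof -
          have k: "\<kappa> * n \<le> \<eta> / 2"
          proof -
            have "\<kappa> * n \<le> \<kappa> * d" using n \<eta> by (intro mult_left_mono) (auto simp: \<kappa>_def)
            then show ?thesis using V(4) by (simp add: \<kappa>_def)
          qed
          have "2 * t * \<tau> * (1 - n / d) \<le> d * (1 - n / d)"
          proof (rule mult_right_mono)
            have "2 * t * \<tau> \<le> 2 * t * \<bar>\<tau>\<bar>" using t by simp
            then show "2 * t * \<tau> \<le> d" using t_\<tau> by linarith
            show "0 \<le> 1 - n / d" using n V(4) by simp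
          qed
          also have "d * (1 - n / d) = d - n" using V(4) by (simp add: field_simps)
          finally have 1: "2 * t * \<tau> * (1 - n / d) \<le> d - n" .
          have 2: "2 * t * (\<kappa> * n) \<le> 2 * t * (\<eta> / 2)" using k t by (intro mult_left_mono) auto
          have 3: "t * (t * C) \<le> t * \<eta>" using t_C t by (intro mult_left_mono) auto
          have "n + 2 * t * (\<tau> - \<eta> - (\<tau> / d - \<kappa>) * n) + t\<^sup>2 * C
              = n + 2 * t * \<tau> * (1 - n / d) + 2 * t * (\<kappa> * n) - 2 * t * \<eta> + t * (t * C)"
            by (simp add: power2_eq_square algebra_simps)
          also have "\<dots> \<le> d" using 1 2 3 by simp
          finally show ?thesis .
        qed
        finally show "(\<Sum>i<d. (cmod (b' i x))\<^sup>2) \<le> d" .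
      qed
      from max[OF this] have "(\<Prod>i<d. cmod (S (b' i) (u i))) \<le> (\<Prod>i<d. cmod (S (b i) (u i)))" .
      moreover have "S (b' i) (u i) = S (b i) (u i) * of_real (1 + t * a i)" if i: "i < d" for i
      proof -
        have "S (lincomb i (\<lambda>j. 2 * H j i) b) (u i) = (\<Sum>l<i. 2 * H l i * S (b l) (u i))"
          using i bV uV by (intro S.lincomb_left) auto
        also have "\<dots> = 0" using i tri by (intro sum.neutral) auto
        finally have "S (p i) (u i) = of_real (a i) * S (b i) (u i)"
          using i bV uV by (simp add: p_def S.add S.scale S.V_intros)
        then show ?thesis
          using i bV uV pV by (simp add: b'_def S.add S.scale S.V_intros algebra_simps)
      qed
      then have "(\<Prod>i<d. cmod (S (b' i) (u i))) =
          (\<Prod>i<d. cmod (S (b i) (u i))) * \<bar>\<Prod>i<d. 1 + t * a i\<bar>"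
        by (simp add: norm_mult prod.distrib abs_prod del: of_real_add of_real_mult)
      ultimately have "\<bar>\<Prod>i<d. 1 + t * a i\<bar> \<le> 1" using F_pos by simp
      with t0(2)[OF t tt0] show False by simp
    qed
  qed
  with G bound that show ?thesis by blast
qed

section \<open>Stable sampling and the least squares projection\<close>

text \<open>
  The constant of the selection for the extremal inner product is better than needed, and the
  inner product controls the sup norm.
\<close>
theorem uniform_sampling:
  fixes V :: "('a \<Rightarrow> complex) set" and d n :: nat
  assumes V: "cfun.subspace V" "V \<subseteq> bounded_funs D" "cfun.dim V = d" "d \<ge> 1" and n: "n > d"
  obtains x where "\<And>i. i \<in> {1..n} \<Longrightarrow> x i \<in> D"
    and "\<And>g y. g \<in> V \<Longrightarrow> y \<in> D \<Longrightarrow>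
      (sqrt n - sqrt d)\<^sup>2 * (cmod (g y))\<^sup>2 \<le> d * (\<Sum>i=1..n. (cmod (g (x i)))\<^sup>2)"
proof -
  obtain G where G: "pd_form V G" "isotropic D V G"
    and sup: "\<And>g x. g \<in> V \<Longrightarrow> x \<in> D \<Longrightarrow> (cmod (g x))\<^sup>2 \<le> d * Re (G g g)"
    using uniform_design[OF V] by blast
  interpret G: pd_form V G by fact
  obtain c where c: "sampling_constant d n c" "c > (sqrt n - sqrt d)\<^sup>2"
    using sampling_constant_exists[OF V(4) n] by blast
  obtain x where x: "\<And>i. i \<in> {1..n} \<Longrightarrow> x i \<in> D"
    and lower: "\<And>g. g \<in> V \<Longrightarrow> c * Re (G g g) \<le> (\<Sum>i=1..n. (cmod (g (x i)))\<^sup>2)"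
    using G.isotropic_sampling[OF V(4,3) G(2) c(1)] by blast
  have cpos: "c \<ge> 0" using c(2) zero_le_power2[of "sqrt n - sqrt d"] by linarith
  show ?thesis
  proof (rule that[OF x])
    fix g y assume g: "g \<in> V" and y: "y \<in> D"
    have "(sqrt n - sqrt d)\<^sup>2 * (cmod (g y))\<^sup>2 \<le> c * (d * Re (G g g))"
      using c(2) sup[OF g y] cpos by (intro mult_mono) auto
    also have "\<dots> = d * (c * Re (G g g))" by simp
    also have "\<dots> \<le> d * (\<Sum>i=1..n. (cmod (g (x i)))\<^sup>2)" using lower[OF g] by (intro mult_left_mono) auto
    finally show "(sqrt n - sqrt d)\<^sup>2 * (cmod (g y))\<^sup>2 \<le> d * (\<Sum>i=1..n. (cmod (g (x i)))\<^sup>2)" .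
  qed
qed

lemma L2_funs_integrable_mult:
  assumes "f \<in> L2_funs M" "g \<in> L2_funs M"
  shows "integrable M (\<lambda>x. f x * cnj (g x))"
proof (rule Bochner_Integration.integrable_bound)
  show "integrable M (\<lambda>x. (cmod (f x))\<^sup>2 + (cmod (g x))\<^sup>2)"
    using assms by (auto simp: L2_funs_def)
  have "(cnj :: complex \<Rightarrow> complex) \<in> borel_measurable borel"
    by (intro borel_measurable_continuous_onI continuous_intros)
  moreover have "f \<in> borel_measurable M" "g \<in> borel_measurable M"
    using assms by (auto simp: L2_funs_def)
  ultimately show "(\<lambda>x. f x * cnj (g x)) \<in> borel_measurable M"
    by (intro borel_measurable_times measurable_compose[of g M borel cnj borel])
  have "a * b \<le> a\<^sup>2 + b\<^sup>2" if "0 \<le> a" "0 \<le> b" for a b :: real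
    using sum_squares_bound[of a b] mult_nonneg_nonneg[OF that] by linarith
  then show "AE x in M. norm (f x * cnj (g x)) \<le> norm ((cmod (f x))\<^sup>2 + (cmod (g x))\<^sup>2)"
    by (simp add: norm_mult)
qed

text \<open>
  The functions in \<open>V\<close> that vanish almost everywhere are invisible to the inner product of \<open>L2\<close>. The mixture of the
  \<open>L2\<close> form with weight \<open>1 - t\<close> and an averaged discrete form on a unisolvent set \<open>Z\<close> with weight \<open>t\<close>
  is positive definite, and it is isotropic as an average over a probability measure. The weight \<open>t\<close> is chosen such that
  the loss of the factor \<open>1 - t\<close> uses up exactly the room in the constant \<open>c\<close> of the selection.
\<close>
theorem L2_sampling:
  fixes M :: "'a measure" and d n :: nat
  assumes "prob_space M"
    and V: "cfun.subspace V" "V \<subseteq> L2_funs M" "cfun.dim V = d" "d \<ge> 1" and n: "n > d"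
  obtains x where "\<And>i. i \<in> {1..n} \<Longrightarrow> x i \<in> space M"
    and "\<And>g. g \<in> V \<Longrightarrow> (sqrt n - sqrt d)\<^sup>2 * (\<integral>y. (cmod (g y))\<^sup>2 \<partial>M) \<le> (\<Sum>i=1..n. (cmod (g (x i)))\<^sup>2)"
    and "\<forall>g\<in>V. (\<forall>i\<in>{1..n}. g (x i) = 0) \<longrightarrow> g = 0"
proof -
  interpret prob_space M by fact
  have sup: "V \<subseteq> supported_on (space M)" using V(2) by (auto simp: L2_funs_def supported_on_def)
  obtain Z where Z: "finite Z" "Z \<subseteq> space M" "pd_form V (sample_form Z (\<lambda>z. z))"
    using unisolvent_points[OF V(1) sup V(3,4)] by blast
  interpret S: pd_form V "sample_form Z (\<lambda>z. z)" by fact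
  obtain u where "orthonormal_basis V (sample_form Z (\<lambda>z. z)) d u"
    using S.orthonormal_basis_exists V(3,4) by blast
  then have "sample_form Z (\<lambda>z. z) (u 0) (u 0) = 1" using V(4) by (simp add: orthonormal_basis_def)
  then have "Z \<noteq> {}" by (auto simp: sample_form_def)
  then have k: "real (card Z) > 0" using Z(1) by (simp add: card_gt_0_iff)
  obtain c where c: "sampling_constant d n c" "c > (sqrt n - sqrt d)\<^sup>2"
    using sampling_constant_exists[OF V(4) n] by blast
  have c0: "(sqrt n - sqrt d)\<^sup>2 > 0" using n by simp
  have cpos: "c > 0" using c(2) c0 by linarith
  define t where "t = 1 - (sqrt n - sqrt d)\<^sup>2 / c"
  have t: "0 < t" "t < 1"
    using c(2) divide_pos_pos[OF c0 cpos] cpos by (auto simp: t_def pos_divide_less_eq)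
  have ct: "c * (1 - t) = (sqrt n - sqrt d)\<^sup>2" using cpos by (simp add: t_def)
  define s where "s = t / card Z"
  have s: "s > 0" using t k by (simp add: s_def)
  define G where "G = (\<lambda>f g. of_real (1 - t) * (\<integral>y. f y * cnj (g y) \<partial>M) + of_real s * sample_form Z (\<lambda>z. z) f g)"
  have G_diag: "Re (G f f) = (1 - t) * (\<integral>y. (cmod (f y))\<^sup>2 \<partial>M) + s * (\<Sum>z\<in>Z. (cmod (f z))\<^sup>2)" for f
  proof -
    have "(\<integral>y. f y * cnj (f y) \<partial>M) = of_real (\<integral>y. (cmod (f y))\<^sup>2 \<partial>M)"
      unfolding complex_norm_square[symmetric] by (rule integral_complex_of_real)
    then show ?thesis unfolding G_def sample_form_diag by simp
  qed
  have int: "integrable M (\<lambda>y. f y * cnj (g y))" if "f \<in> V" "g \<in> V" for f g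
    using L2_funs_integrable_mult V(2) that by blast
  interpret G: pd_form V G
  proof
    show "cfun.subspace V" by fact
    show "G (f + g) h = G f h + G g h" if "f \<in> V" "g \<in> V" "h \<in> V" for f g h
      using that by (simp add: G_def S.add distrib_right int algebra_simps)
    show "G (smult a f) h = a * G f h" if "f \<in> V" "h \<in> V" for a f h
      using that by (simp add: G_def S.scale mult.assoc algebra_simps)
    show "G f g = cnj (G g f)" if "f \<in> V" "g \<in> V" for f g
    proof -
      have "(\<integral>y. f y * cnj (g y) \<partial>M) = (\<integral>y. cnj (g y * cnj (f y)) \<partial>M)" by (simp add: mult.commute)
      also have "\<dots> = cnj (\<integral>y. g y * cnj (f y) \<partial>M)" by (rule Bochner_Integration.integral_cnj)
      finally show ?thesis using S.herm[OF that] by (simp only: G_def complex_cnj_add complex_cnj_mult complex_cnj_complex_of_real)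
    qed
    show "0 < Re (G f f)" if "f \<in> V" "f \<noteq> 0" for f
    proof -
      have "(\<Sum>z\<in>Z. (cmod (f z))\<^sup>2) > 0" using S.pos[OF that] unfolding sample_form_diag by simp
      then show ?thesis unfolding G_diag using t s by (intro add_nonneg_pos mult_nonneg_nonneg mult_pos_pos) auto
    qed
  qed
  have "isotropic (space M) V G"
    unfolding isotropic_def
  proof (intro allI impI)
    fix N :: nat and w :: "nat \<Rightarrow> real" and h :: "nat \<Rightarrow> 'a \<Rightarrow> complex" and \<eta> :: real
    assume hV: "\<forall>i<N. h i \<in> V" and \<eta>: "\<eta> > 0"
    define q where "q = (\<lambda>x. \<Sum>i<N. w i * (cmod (h i x))\<^sup>2)"
    define \<tau> where "\<tau> = (\<Sum>i<N. w i * Re (G (h i) (h i)))"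
    have h_int: "integrable M (\<lambda>y. (cmod (h i y))\<^sup>2)" if "i < N" for i
      using hV V(2) that by (auto simp: L2_funs_def)
    have q_int: "integrable M q" unfolding q_def using h_int by auto
    have "\<tau> = (1 - t) * (\<integral>y. q y \<partial>M) + s * (\<Sum>z\<in>Z. q z)"
    proof -
      have "(\<integral>y. q y \<partial>M) = (\<Sum>i<N. w i * (\<integral>y. (cmod (h i y))\<^sup>2 \<partial>M))"
        unfolding q_def using h_int by (subst Bochner_Integration.integral_sum) auto
      moreover have "(\<Sum>z\<in>Z. q z) = (\<Sum>i<N. w i * (\<Sum>z\<in>Z. (cmod (h i z))\<^sup>2))"
        unfolding q_def sum_distrib_left by (rule sum.swap)
      ultimately show ?thesis unfolding \<tau>_def G_diag
        by (simp add: sum_distrib_left sum.distrib distrib_left mult_ac)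
    qed
    moreover have "\<tau> - \<eta> < \<tau>" using \<eta> by simp
    moreover have "(1 - t) * (\<integral>y. q y \<partial>M) + s * (\<Sum>z\<in>Z. q z) \<le> \<tau> - \<eta>" if le: "\<And>x. x \<in> space M \<Longrightarrow> q x \<le> \<tau> - \<eta>"
    proof -
      have "(\<integral>y. q y \<partial>M) \<le> (\<integral>y. \<tau> - \<eta> \<partial>M)" using q_int le by (intro integral_mono) auto
      then have 1: "(1 - t) * (\<integral>y. q y \<partial>M) \<le> (1 - t) * (\<tau> - \<eta>)" using t
        by (intro mult_left_mono) (auto simp: prob_space)
      have "(\<Sum>z\<in>Z. q z) \<le> card Z * (\<tau> - \<eta>)" using le Z(2) by (intro sum_bounded_above) auto
      then have "s * (\<Sum>z\<in>Z. q z) \<le> s * (card Z * (\<tau> - \<eta>))" using s by (intro mult_left_mono) auto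
      also have "\<dots> = t * (\<tau> - \<eta>)" using k by (simp add: s_def)
      finally show ?thesis using 1 by (simp add: algebra_simps)
    qed
    ultimately have "\<exists>x\<in>space M. \<tau> - \<eta> < q x" by (meson not_less)
    then show "\<exists>x\<in>space M. (\<Sum>i<N. w i * Re (G (h i) (h i))) - \<eta> < (\<Sum>i<N. w i * (cmod (h i x))\<^sup>2)"
      by (simp add: q_def \<tau>_def)
  qed
  then obtain x where x: "\<And>i. i \<in> {1..n} \<Longrightarrow> x i \<in> space M"
    and lower: "\<And>g. g \<in> V \<Longrightarrow> c * Re (G g g) \<le> (\<Sum>i=1..n. (cmod (g (x i)))\<^sup>2)"
    using G.isotropic_sampling[OF V(4,3) _ c(1)] by blast
  show ?thesis
  proof (rule that[OF x])
    fix g assume g: "g \<in> V"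
    have "(1 - t) * (\<integral>y. (cmod (g y))\<^sup>2 \<partial>M) \<le> Re (G g g)"
      unfolding G_diag using s by (simp add: sum_nonneg)
    then have "c * ((1 - t) * (\<integral>y. (cmod (g y))\<^sup>2 \<partial>M)) \<le> c * Re (G g g)"
      using cpos by (intro mult_left_mono) auto
    then have "c * (1 - t) * (\<integral>y. (cmod (g y))\<^sup>2 \<partial>M) \<le> c * Re (G g g)" by (simp only: mult.assoc)
    then show "(sqrt n - sqrt d)\<^sup>2 * (\<integral>y. (cmod (g y))\<^sup>2 \<partial>M) \<le> (\<Sum>i=1..n. (cmod (g (x i)))\<^sup>2)"
      unfolding ct using lower[OF g] by linarith
  next
    show "\<forall>g\<in>V. (\<forall>i\<in>{1..n}. g (x i) = 0) \<longrightarrow> g = 0"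
    proof (intro ballI impI)
      fix g assume g: "g \<in> V" "\<forall>i\<in>{1..n}. g (x i) = 0"
      then have "(\<Sum>i=1..n. (cmod (g (x i)))\<^sup>2) = 0" by (intro sum.neutral) auto
      then have "c * Re (G g g) \<le> 0" using lower[OF g(1)] by simp
      then have "Re (G g g) \<le> 0" using cpos by (simp add: mult_le_0_iff)
      then show "g = 0" by (rule G.eq_0I[OF g(1)])
    qed
  qed
qed

text \<open>
  The minimizer is the orthogonal projection of the data for the inner product given by the sample points, and the equation
  is the theorem of Pythagoras.
\<close>
lemma least_squares_projection:
  assumes V: "cfun.subspace V" "cfun.dim V = d" "d \<ge> 1"
    and inj: "\<forall>g\<in>V. (\<forall>i\<in>{1..N}. g (x i) = 0) \<longrightarrow> g = 0"
  obtains g0 where "g0 \<in> V" "\<And>h. h \<in> V \<Longrightarrow>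
    lsq_residual N x y h = lsq_residual N x y g0 + (\<Sum>i=1..N. (cmod (h (x i) - g0 (x i)))\<^sup>2)"
proof -
  define S where "S = (sample_form {1..N} x :: _ \<Rightarrow> ('a \<Rightarrow> complex) \<Rightarrow> complex)"
  interpret S: pd_form V S unfolding S_def
  proof (rule pd_sample_form[OF _ V(1)])
    show "g = 0" if "g \<in> V" "\<And>i. i \<in> {1..N} \<Longrightarrow> g (x i) = 0" for g
      by (rule inj[rule_format]) (fact that)+
  qed simp
  obtain u where u: "orthonormal_basis V S d u" using S.orthonormal_basis_exists V by blast
  have uV: "\<And>i. i < d \<Longrightarrow> u i \<in> V" using u by (simp add: orthonormal_basis_def)
  define c where "c = (\<lambda>j. \<Sum>i=1..N. y i * cnj (u j (x i)))"
  define g0 where "g0 = lincomb d c u"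
  have g0: "g0 \<in> V" unfolding g0_def by (rule S.V_lincomb) (rule uV)
  have orth: "(\<Sum>i=1..N. (y i - g0 (x i)) * cnj (h (x i))) = 0" if h: "h \<in> V" for h
  proof -
    have hx: "h (x i) = (\<Sum>j<d. S h (u j) * u j (x i))" for i
      using u h unfolding orthonormal_basis_def lincomb_def by metis
    have "(\<Sum>i=1..N. y i * cnj (h (x i))) = (\<Sum>i=1..N. \<Sum>j<d. cnj (S h (u j)) * (y i * cnj (u j (x i))))"
      by (intro sum.cong refl) (simp only: hx cnj_sum sum_distrib_left complex_cnj_mult mult_ac)
    also have "\<dots> = (\<Sum>j<d. \<Sum>i=1..N. cnj (S h (u j)) * (y i * cnj (u j (x i))))" by (rule sum.swap)
    also have "\<dots> = (\<Sum>j<d. c j * cnj (S h (u j)))"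
      by (simp only: c_def sum_distrib_left[symmetric] mult.commute)
    also have "\<dots> = (\<Sum>j<d. c j * S (u j) h)"
    proof (intro sum.cong refl)
      fix j assume "j \<in> {..<d}"
      then have "S (u j) h = cnj (S h (u j))" by (intro S.herm uV h) simp
      then show "c j * cnj (S h (u j)) = c j * S (u j) h" by simp
    qed
    also have "\<dots> = S g0 h" unfolding g0_def using uV h by (intro S.lincomb_left[symmetric]) auto
    also have "\<dots> = (\<Sum>i=1..N. g0 (x i) * cnj (h (x i)))" by (simp add: S_def sample_form_def)
    finally show ?thesis by (simp add: left_diff_distrib sum_subtractf)
  qed
  show ?thesis
  proof (rule that[OF g0])
    fix h assume h: "h \<in> V"
    have "(cmod (y i - h (x i)))\<^sup>2 = (cmod (y i - g0 (x i)))\<^sup>2 + (cmod (h (x i) - g0 (x i)))\<^sup>2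
        - 2 * Re ((y i - g0 (x i)) * cnj ((h - g0) (x i)))" for i
      unfolding cmod_power2 by (simp add: power2_eq_square algebra_simps)
    then have "lsq_residual N x y h = lsq_residual N x y g0 + (\<Sum>i=1..N. (cmod (h (x i) - g0 (x i)))\<^sup>2)
        - 2 * Re (\<Sum>i=1..N. (y i - g0 (x i)) * cnj ((h - g0) (x i)))"
      unfolding lsq_residual_def Re_sum by (simp only: sum.distrib sum_subtractf sum_distrib_left)
    then show "lsq_residual N x y h = lsq_residual N x y g0 + (\<Sum>i=1..N. (cmod (h (x i) - g0 (x i)))\<^sup>2)"
      unfolding orth[OF S.V_diff[OF h g0]] by simp
  qed
qed

lemma least_squares_unique:
  assumes V: "cfun.subspace V" "cfun.dim V = d" "d \<ge> 1"
    and inj: "\<forall>g\<in>V. (\<forall>i\<in>{1..N}. g (x i) = 0) \<longrightarrow> g = 0"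
  shows "\<exists>!g. is_arg_min (lsq_residual N x y) (\<lambda>h. h \<in> V) g"
    and "lsq V N x y \<in> V"
    and "h \<in> V \<Longrightarrow> (\<Sum>i=1..N. (cmod (h (x i) - lsq V N x y (x i)))\<^sup>2) \<le> lsq_residual N x y h"
proof -
  obtain g0 where g0: "g0 \<in> V" and pyth: "\<And>h. h \<in> V \<Longrightarrow>
    lsq_residual N x y h = lsq_residual N x y g0 + (\<Sum>i=1..N. (cmod (h (x i) - g0 (x i)))\<^sup>2)"
    using least_squares_projection[OF V inj] by blast
  have min: "is_arg_min (lsq_residual N x y) (\<lambda>h. h \<in> V) g0"
    unfolding is_arg_min_linorder using g0
  proof (intro conjI allI impI)
    fix h assume "h \<in> V"
    have "0 \<le> (\<Sum>i=1..N. (cmod (h (x i) - g0 (x i)))\<^sup>2)" by (intro sum_nonneg) auto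
    then show "lsq_residual N x y g0 \<le> lsq_residual N x y h" using pyth[OF \<open>h \<in> V\<close>] by linarith
  qed
  have uniq: "g = g0" if "is_arg_min (lsq_residual N x y) (\<lambda>h. h \<in> V) g" for g
  proof -
    have g: "g \<in> V" and le: "lsq_residual N x y g \<le> lsq_residual N x y g0"
      using that g0 unfolding is_arg_min_linorder by auto
    have "(\<Sum>i=1..N. (cmod (g (x i) - g0 (x i)))\<^sup>2) \<le> 0" using pyth[OF g] le by linarith
    then have "(\<Sum>i=1..N. (cmod (g (x i) - g0 (x i)))\<^sup>2) = 0" by (intro antisym sum_nonneg) auto
    then have "\<forall>i\<in>{1..N}. (cmod (g (x i) - g0 (x i)))\<^sup>2 = 0" by (subst (asm) sum_nonneg_eq_0_iff) auto
    then have "\<And>i. i \<in> {1..N} \<Longrightarrow> (g - g0) (x i) = 0" by simp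
    then have "g - g0 = 0" by (intro inj[rule_format] cfun.subspace_diff[OF V(1)] g g0)
    then show ?thesis by simp
  qed
  have lsq: "lsq V N x y = g0" unfolding lsq_def arg_min_def using min uniq by (rule some_equality)
  show "\<exists>!g. is_arg_min (lsq_residual N x y) (\<lambda>h. h \<in> V) g" using min uniq by (rule ex1I)
  show "lsq V N x y \<in> V" unfolding lsq by (rule g0)
  show "(\<Sum>i=1..N. (cmod (h (x i) - lsq V N x y (x i)))\<^sup>2) \<le> lsq_residual N x y h" if "h \<in> V"
  proof -
    have "0 \<le> lsq_residual N x y g0" unfolding lsq_residual_def by (intro sum_nonneg) auto
    then show ?thesis unfolding lsq using pyth[OF that] by linarith
  qed
qed

section \<open>Error bounds in the Lp norm\<close>

text \<open>
  This inequality yields the triangle inequality for the sum of the constant \<open>a\<close> and a function \<open>s\<close>. Convexity of the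
  power is applied to \<open>(a + s) / (a + b)\<close> as a convex combination of \<open>1\<close> and \<open>s / b\<close>, and \<open>s powr P\<close> is
  bounded by \<open>R powr (P - 2) * s\<^sup>2\<close>. Integration over a probability space makes the bracket at most \<open>1\<close> when
  \<open>s\<^sup>2\<close> has integral at most \<open>K\<^sup>2\<close>.
\<close>
lemma powr_convex_bound:
  fixes P a b s K R :: real
  assumes P: "P \<ge> 2" and a: "a > 0" and K: "K > 0" and R: "R > 0" and s: "s \<ge> 0"
    and sR: "P \<noteq> 2 \<Longrightarrow> s \<le> R" and b: "b > 0" "b powr P = R powr (P - 2) * K\<^sup>2"
  shows "(a + s) powr P \<le> (a + b) powr P * (a / (a + b) + b / (a + b) * (s\<^sup>2 / K\<^sup>2))"
proof -
  define c where "c = a + b"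
  have c: "c > 0" using a b by (simp add: c_def)
  have ratio: "(s / b) powr P \<le> s\<^sup>2 / K\<^sup>2"
  proof (cases "s = 0")
    case False
    then have s0: "s > 0" using s by simp
    have "s powr P = s powr (P - 2) * s\<^sup>2"
    proof -
      have "s powr P = s powr ((P - 2) + 2)" by simp
      also have "\<dots> = s powr (P - 2) * s powr 2" by (rule powr_add)
      finally show ?thesis using s0 by (simp add: powr_numeral)
    qed
    also have "\<dots> \<le> R powr (P - 2) * s\<^sup>2"
    proof (cases "P = 2")
      case True
      then show ?thesis using s0 R by simp
    next
      case False
      then show ?thesis using sR P s by (intro mult_right_mono powr_mono2) auto
    qed
    also have "\<dots> = b powr P * (s\<^sup>2 / K\<^sup>2)" using b(2) K by simp
    finally show ?thesis using b(1) s0 by (simp add: powr_divide field_simps)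
  qed simp
  have "((a + s) / c) powr P \<le> a / c + b / c * (s / b) powr P"
  proof (cases "s = 0")
    case True
    have "(a / c) powr P \<le> (a / c) powr 1" using a b P
      by (intro powr_mono') (auto simp: c_def)
    then show ?thesis using True a c by simp
  next
    case False
    then have s0: "s / b > 0" using s b by simp
    have "((1 - b / c) *\<^sub>R 1 + (b / c) *\<^sub>R (s / b)) powr P \<le> (1 - b / c) * 1 powr P + (b / c) * (s / b) powr P"
      by (rule convex_onD[OF powr_convex]) (use P a b s0 in \<open>auto simp: c_def\<close>)
    moreover have "1 - b / c = a / c" using c by (simp add: c_def field_simps)
    moreover have "a / c + b / c * (s / b) = (a + s) / c" using b(1) by (simp add: add_divide_distrib)
    ultimately show ?thesis by simp
  qed
  also have "\<dots> \<le> a / c + b / c * (s\<^sup>2 / K\<^sup>2)"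
    using ratio b(1) c by (intro add_left_mono mult_left_mono) auto
  finally have "c powr P * ((a + s) / c) powr P \<le> c powr P * (a / c + b / c * (s\<^sup>2 / K\<^sup>2))"
    by (intro mult_left_mono) auto
  moreover have "c powr P * ((a + s) / c) powr P = (a + s) powr P"
    using c a s by (simp add: powr_divide)
  ultimately show ?thesis by (simp add: c_def)
qed

text \<open>
  Here \<open>b\<close> is the interpolated bound for the norm of \<open>h\<close>: it satisfies \<open>b powr P = R powr (P - 2) * K\<^sup>2\<close>, where
  \<open>R = sqrt \<mu> * K\<close> bounds \<open>h\<close> uniformly. For \<open>P = 2\<close> the exponent of \<open>R\<close> is \<open>0\<close>, and the bound
  involves only the square integral of \<open>h\<close>.
\<close>
lemma fun_norm_perturbation_pos:
  fixes M :: "'a measure" and p :: ennreal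
  assumes "prob_space M" and p: "2 \<le> p" "p < \<infinity>" and \<mu>: "\<mu> \<ge> 1" and a: "a > 0" and K: "K > 0"
    and k: "\<And>x. x \<in> space M \<Longrightarrow> cmod (k x) \<le> a + cmod (h x)"
    and h: "integrable M (\<lambda>x. (cmod (h x))\<^sup>2)" "(\<integral>x. (cmod (h x))\<^sup>2 \<partial>M) \<le> K\<^sup>2"
    and h_sup: "\<And>x. p \<noteq> 2 \<Longrightarrow> x \<in> space M \<Longrightarrow> (cmod (h x))\<^sup>2 \<le> \<mu> * K\<^sup>2"
  shows "fun_norm M p k \<le> ennreal (a + \<mu> powr (1/2 - enn2real (1/p)) * K)"
proof -
  interpret prob_space M by fact
  define P where "P = enn2real p"
  have p_eq: "p = ennreal P" using p(2) by (simp add: P_def)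
  have P: "P \<ge> 2"
  proof -
    have "ennreal 2 \<le> ennreal P" using p(1) p_eq by simp
    then show ?thesis by (simp add: ennreal_le_iff2)
  qed
  have inv: "enn2real (1/p) = 1 / P"
    using P by (simp add: p_eq divide_ennreal[of 1 P, symmetric] flip: ennreal_1)
  define b where "b = \<mu> powr (1/2 - 1/P) * K"
  define R where "R = sqrt \<mu> * K"
  have b: "b > 0" and R: "R > 0" using \<mu> K by (auto simp: b_def R_def)
  have bP: "b powr P = R powr (P - 2) * K\<^sup>2"
  proof -
    have "b powr P = \<mu> powr ((1/2 - 1/P) * P) * K powr P"
      using \<mu> K by (simp add: b_def powr_mult powr_powr)
    also have "(1/2 - 1/P) * P = (1/2) * (P - 2)" using P by (simp add: field_simps)
    also have "K powr P = K powr (P - 2) * K\<^sup>2"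
    proof -
      have "K powr P = K powr ((P - 2) + 2)" by simp
      also have "\<dots> = K powr (P - 2) * K powr 2" by (rule powr_add)
      finally show ?thesis using K by (simp add: powr_numeral)
    qed
    also have "\<mu> powr ((1/2) * (P - 2)) = (sqrt \<mu>) powr (P - 2)"
      unfolding powr_powr[symmetric] using \<mu> by (simp only: powr_half_sqrt)
    finally show ?thesis using \<mu> K by (simp add: R_def powr_mult)
  qed
  define c where "c = a + b"
  have c: "c > 0" using a b by (simp add: c_def)
  define \<Phi> where "\<Phi> = (\<lambda>s. c powr P * (a / c + b / c * (s / K\<^sup>2)))"
  have \<Phi>_nonneg: "0 \<le> \<Phi> s" if "0 \<le> s" for s
    using that a b c unfolding \<Phi>_def by (intro mult_nonneg_nonneg add_nonneg_nonneg) auto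
  have pointwise: "cmod (k x) powr P \<le> \<Phi> ((cmod (h x))\<^sup>2)" if x: "x \<in> space M" for x
  proof -
    have "cmod (k x) powr P \<le> (a + cmod (h x)) powr P" using k[OF x] P by (intro powr_mono2) auto
    also have "\<dots> \<le> \<Phi> ((cmod (h x))\<^sup>2)"
      unfolding \<Phi>_def c_def
    proof (rule powr_convex_bound[OF P a K R _ _ b bP])
      assume "P \<noteq> 2"
      then have "p \<noteq> 2" by (auto simp: P_def)
      from h_sup[OF this x] show "cmod (h x) \<le> R"
        unfolding R_def using \<mu> K by (metis real_le_rsqrt real_sqrt_mult real_sqrt_abs abs_of_pos)
    qed simp
    finally show ?thesis .
  qed
  have \<Phi>_int: "integrable M (\<lambda>x. \<Phi> ((cmod (h x))\<^sup>2))" unfolding \<Phi>_def using h(1) by simp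
  have "(\<integral>\<^sup>+x. ennreal (cmod (k x) powr P) \<partial>M) \<le> (\<integral>\<^sup>+x. ennreal (\<Phi> ((cmod (h x))\<^sup>2)) \<partial>M)"
    by (intro nn_integral_mono ennreal_leI pointwise)
  also have "\<dots> = ennreal (\<integral>x. \<Phi> ((cmod (h x))\<^sup>2) \<partial>M)"
    by (rule nn_integral_eq_integral[OF \<Phi>_int]) (simp add: \<Phi>_nonneg)
  also have "(\<integral>x. \<Phi> ((cmod (h x))\<^sup>2) \<partial>M) = \<Phi> (\<integral>x. (cmod (h x))\<^sup>2 \<partial>M)"
    unfolding \<Phi>_def using h(1) by (simp add: prob_space)
  also have "ennreal (\<Phi> (\<integral>x. (cmod (h x))\<^sup>2 \<partial>M)) \<le> ennreal (c powr P)"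
  proof (rule ennreal_leI)
    have "\<Phi> (\<integral>x. (cmod (h x))\<^sup>2 \<partial>M) \<le> c powr P * (a / c + b / c * 1)"
      unfolding \<Phi>_def using h(2) K a b c
      by (intro mult_left_mono add_left_mono) auto
    also have "a / c + b / c * 1 = 1" using c by (simp add: c_def flip: add_divide_distrib)
    finally show "\<Phi> (\<integral>x. (cmod (h x))\<^sup>2 \<partial>M) \<le> c powr P" by simp
  qed
  finally have I: "(\<integral>\<^sup>+x. ennreal (cmod (k x) powr P) \<partial>M) \<le> ennreal (c powr P)" .
  define I where "I = (\<integral>\<^sup>+x. ennreal (cmod (k x) powr P) \<partial>M)"
  have fin: "I \<noteq> \<infinity>" using I unfolding I_def[symmetric] by (auto simp: top_unique)
  have "enn2real I \<le> c powr P" using I unfolding I_def[symmetric] by (intro enn2real_leI) auto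
  then have "enn2real I powr (1 / P) \<le> (c powr P) powr (1 / P)" using P by (intro powr_mono2) auto
  also have "\<dots> = c" using c P by (simp add: powr_powr)
  finally have "ennreal (enn2real I powr (1 / P)) \<le> ennreal c" by (rule ennreal_leI)
  moreover have "fun_norm M p k = ennreal (enn2real I powr (1 / P))"
    using p(2) fin unfolding fun_norm_def P_def[symmetric] I_def[symmetric] Let_def by auto
  ultimately show ?thesis by (simp add: inv c_def b_def)
qed

text \<open>
  The degenerate cases \<open>a = 0\<close> and \<open>K = 0\<close> follow by letting positive bounds decrease.
\<close>
lemma fun_norm_perturbation:
  fixes M :: "'a measure" and p :: ennreal
  assumes "prob_space M" and p: "2 \<le> p" "p < \<infinity>" and \<mu>: "\<mu> \<ge> 1" and a: "a \<ge> 0" and K: "K \<ge> 0"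
    and k: "\<And>x. x \<in> space M \<Longrightarrow> cmod (k x) \<le> a + cmod (h x)"
    and h: "integrable M (\<lambda>x. (cmod (h x))\<^sup>2)" "(\<integral>x. (cmod (h x))\<^sup>2 \<partial>M) \<le> K\<^sup>2"
    and h_sup: "\<And>x. p \<noteq> 2 \<Longrightarrow> x \<in> space M \<Longrightarrow> (cmod (h x))\<^sup>2 \<le> \<mu> * K\<^sup>2"
  shows "fun_norm M p k \<le> ennreal (a + \<mu> powr (1/2 - enn2real (1/p)) * K)"
proof (rule ennreal_le_epsilon)
  fix e :: real assume e: "e > 0"
  define B where "B = \<mu> powr (1/2 - enn2real (1/p))"
  have B: "B \<ge> 0" by (simp add: B_def)
  \<comment> \<open>Enlarging both \<open>a\<close> and \<open>K\<close> by \<open>r\<close> enlarges the bound by \<open>r * (1 + B)\<close>.\<close>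
  define r where "r = e / (1 + B)"
  have r: "r > 0" using e B by (simp add: r_def)
  have KK: "K\<^sup>2 \<le> (K + r)\<^sup>2" using K r by (intro power_mono) auto
  have "fun_norm M p k \<le> ennreal ((a + r) + B * (K + r))"
    unfolding B_def
  proof (rule fun_norm_perturbation_pos[OF assms(1) p \<mu> _ _ _ h(1)])
    show "cmod (k x) \<le> a + r + cmod (h x)" if "x \<in> space M" for x using k[OF that] r by linarith
    show "(\<integral>x. (cmod (h x))\<^sup>2 \<partial>M) \<le> (K + r)\<^sup>2" using h(2) KK by linarith
    show "(cmod (h x))\<^sup>2 \<le> \<mu> * (K + r)\<^sup>2" if "p \<noteq> 2" "x \<in> space M" for x
      using h_sup[OF that] mult_left_mono[OF KK, of \<mu>] \<mu> by linarith
  qed (use a K r in auto)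
  also have "(a + r) + B * (K + r) = (a + B * K) + r * (1 + B)" by (simp add: algebra_simps)
  also have "r * (1 + B) = e" using B by (simp add: r_def)
  also have "ennreal (a + B * K + e) = ennreal (a + B * K) + ennreal e"
    using a B K e by (intro ennreal_plus) auto
  finally show "fun_norm M p k \<le> ennreal (a + \<mu> powr (1/2 - enn2real (1/p)) * K) + ennreal e"
    unfolding B_def .
qed

lemma fun_norm_perturbation_sup:
  assumes \<mu>: "\<mu> \<ge> 0" and a: "a \<ge> 0" and K: "K \<ge> 0"
    and k: "\<And>x. x \<in> space M \<Longrightarrow> cmod (k x) \<le> a + cmod (h x)"
    and h_sup: "\<And>x. x \<in> space M \<Longrightarrow> (cmod (h x))\<^sup>2 \<le> \<mu> * K\<^sup>2"
  shows "fun_norm M \<infinity> k \<le> ennreal (a + \<mu> powr (1/2) * K)"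
proof -
  have "cmod (k x) \<le> a + \<mu> powr (1/2) * K" if x: "x \<in> space M" for x
  proof -
    have "cmod (h x) \<le> sqrt (\<mu> * K\<^sup>2)" by (rule real_le_rsqrt[OF h_sup[OF x]])
    also have "\<dots> = \<mu> powr (1/2) * K" using K \<mu> by (simp add: real_sqrt_mult powr_half_sqrt)
    finally show ?thesis using k[OF x] by linarith
  qed
  then show ?thesis unfolding fun_norm_def by (auto intro!: SUP_least ennreal_leI)
qed

text \<open>
  The error is split as \<open>(f - g) + h\<close>, where \<open>g\<close> is a best uniform approximation of \<open>f\<close> and \<open>h\<close> is the difference of \<open>g\<close> and
  the least squares approximation. The sampled values of \<open>h\<close> are bounded by the residual of \<open>g\<close>, hence
  by the uniform error and the noise, and the stability of the points transfers this bound to \<open>h\<close>.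
\<close>
lemma lsq_error_bound_from_stability:
  fixes M :: "'a measure" and V :: "('a \<Rightarrow> complex) set" and N m :: nat and p :: ennreal and A :: real
  assumes "prob_space M" and p: "2 \<le> p"
    and V: "cfun.subspace V" "V \<subseteq> supported_on (space M)" "cfun.dim V = m" "m \<ge> 1"
    and N: "N \<ge> 1" and x: "\<And>i. i \<in> {1..N} \<Longrightarrow> x i \<in> space M" and A: "A \<ge> 0"
    and inj: "\<forall>g\<in>V. (\<forall>i\<in>{1..N}. g (x i) = 0) \<longrightarrow> g = 0"
    and L2: "\<And>g. p < \<infinity> \<Longrightarrow> g \<in> V \<Longrightarrow> g \<in> L2_funs M \<and>
      N * (\<integral>y. (cmod (g y))\<^sup>2 \<partial>M) \<le> A\<^sup>2 * (\<Sum>i=1..N. (cmod (g (x i)))\<^sup>2)"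
    and unif: "\<And>g y. p \<noteq> 2 \<Longrightarrow> g \<in> V \<Longrightarrow> y \<in> space M \<Longrightarrow>
      N * (cmod (g y))\<^sup>2 \<le> m * A\<^sup>2 * (\<Sum>i=1..N. (cmod (g (x i)))\<^sup>2)"
  shows "lsq_error_bound M V p N x (1 + A * m powr (1/2 - enn2real (1/p)))"
  unfolding lsq_error_bound_def Let_def
proof (intro ballI impI allI conjI)
  fix f and e :: "nat \<Rightarrow> complex"
  assume f: "f \<in> bounded_funs (space M)"
  define y where "y = (\<lambda>i. f (x i) + e i)"
  note ls = least_squares_unique[where y = y and N = N and x = x, OF V(1,3,4) inj]
  show "\<exists>!g. is_arg_min (lsq_residual N x (\<lambda>i. f (x i) + e i)) (\<lambda>h. h \<in> V) g"
    using ls(1) unfolding y_def .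
  obtain g where g: "is_arg_min (\<lambda>h. fun_norm M \<infinity> (f - h)) (\<lambda>h. h \<in> V) g"
    and g_fin: "fun_norm M \<infinity> (f - g) < \<infinity>"
    using best_approximation_exists[OF V f] by blast
  have gV: "g \<in> V" using g by (simp add: is_arg_min_def)
  define a where "a = enn2real (fun_norm M \<infinity> (f - g))"
  have a: "a \<ge> 0" "fun_norm M \<infinity> (f - g) = ennreal a" using g_fin by (simp_all add: a_def)
  have fg: "cmod (f z - g z) \<le> a" if "z \<in> space M" for z
  proof -
    have "ennreal (cmod (f z - g z)) \<le> fun_norm M \<infinity> (f - g)"
      unfolding fun_norm_def using that by (auto intro: SUP_upper2)
    then show ?thesis using a by (simp add: ennreal_le_iff)
  qed
  define \<nu> where "\<nu> = noise_norm N e"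
  have e: "cmod (e i) \<le> \<nu>" if "i \<in> {1..N}" for i
    unfolding \<nu>_def noise_norm_def by (rule Max_ge) (use that in auto)
  have \<nu>: "\<nu> \<ge> 0" using order_trans[OF norm_ge_zero e[of 1]] N by simp
  define ft where "ft = lsq V N x y"
  have ft: "ft \<in> V" unfolding ft_def by (rule ls(2))
  define h where "h = g - ft"
  have hV: "h \<in> V" unfolding h_def by (rule cfun.subspace_diff[OF V(1) gV ft])
  define K where "K = A * (a + \<nu>)"
  have K: "K \<ge> 0" using A a \<nu> by (simp add: K_def)
  have "(\<Sum>i=1..N. (cmod (h (x i)))\<^sup>2) \<le> lsq_residual N x y g"
    using ls(3)[OF gV] by (simp add: h_def ft_def)
  also have "\<dots> \<le> (\<Sum>i=1..N. (a + \<nu>)\<^sup>2)"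
    unfolding lsq_residual_def
  proof (intro sum_mono power_mono)
    fix i assume i: "i \<in> {1..N}"
    have "y i - g (x i) = (f (x i) - g (x i)) + e i" by (simp add: y_def)
    also have "cmod \<dots> \<le> a + \<nu>" by (intro norm_triangle_mono fg e x i)
    finally show "cmod (y i - g (x i)) \<le> a + \<nu>" .
  qed simp
  finally have res: "(\<Sum>i=1..N. (cmod (h (x i)))\<^sup>2) \<le> N * (a + \<nu>)\<^sup>2" by simp
  have AK: "A\<^sup>2 * (\<Sum>i=1..N. (cmod (h (x i)))\<^sup>2) \<le> N * K\<^sup>2"
    using mult_left_mono[OF res, of "A\<^sup>2"] by (simp add: K_def power_mult_distrib mult_ac)
  have h_sup: "(cmod (h z))\<^sup>2 \<le> m * K\<^sup>2" if "p \<noteq> 2" "z \<in> space M" for z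
  proof -
    have "N * (cmod (h z))\<^sup>2 \<le> m * (A\<^sup>2 * (\<Sum>i=1..N. (cmod (h (x i)))\<^sup>2))"
      using unif[OF that(1) hV that(2)] by (simp only: mult.assoc)
    also have "\<dots> \<le> m * (N * K\<^sup>2)" by (intro mult_left_mono AK) simp
    finally have "N * (cmod (h z))\<^sup>2 \<le> N * (m * K\<^sup>2)" by (simp only: mult_ac)
    then show ?thesis using N by (simp add: mult_le_cancel_left)
  qed
  have pert: "cmod ((f - ft) z) \<le> a + cmod (h z)" if "z \<in> space M" for z
  proof -
    have "(f - ft) z = (f z - g z) + h z" by (simp add: h_def)
    also have "cmod \<dots> \<le> a + cmod (h z)" by (intro norm_triangle_mono fg that order_refl)
    finally show ?thesis .
  qed
  have bound: "fun_norm M p (f - ft) \<le> ennreal (a + m powr (1/2 - enn2real (1/p)) * K)"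
  proof (cases "p = \<infinity>")
    case True
    then show ?thesis
      using fun_norm_perturbation_sup[of m a K M "f - ft" h] a(1) K pert h_sup by simp
  next
    case False
    then have fin: "p < \<infinity>" by (simp add: less_top)
    have "N * (\<integral>y. (cmod (h y))\<^sup>2 \<partial>M) \<le> N * K\<^sup>2" using L2[OF fin hV] AK by linarith
    then have "(\<integral>y. (cmod (h y))\<^sup>2 \<partial>M) \<le> K\<^sup>2" using N by (simp add: mult_le_cancel_left)
    moreover have "integrable M (\<lambda>y. (cmod (h y))\<^sup>2)" using L2[OF fin hV] by (simp add: L2_funs_def)
    ultimately show ?thesis
      using V(4) a(1) K pert h_sup by (intro fun_norm_perturbation[OF assms(1) p fin]) auto
  qed
  define B where "B = m powr (1/2 - enn2real (1/p))"
  have B: "B \<ge> 0" by (simp add: B_def)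
  have "a + B * K \<le> (1 + A * B) * (a + \<nu>)" using \<nu> by (simp add: K_def algebra_simps)
  then have "fun_norm M p (f - ft) \<le> ennreal ((1 + A * B) * (a + \<nu>))"
    using bound unfolding B_def[symmetric] by (meson ennreal_leI order_trans)
  also have "\<dots> = ennreal (1 + A * B) * (fun_norm M \<infinity> (f - g) + ennreal \<nu>)"
    using A B a \<nu> by (simp add: ennreal_mult ennreal_plus)
  finally show "\<exists>g. is_arg_min (\<lambda>h. fun_norm M \<infinity> (f - h)) (\<lambda>h. h \<in> V) g \<and>
      fun_norm M p (f - lsq V N x (\<lambda>i. f (x i) + e i))
      \<le> ennreal (1 + A * m powr (1/2 - enn2real (1/p))) * (fun_norm M \<infinity> (f - g) + ennreal (noise_norm N e))"
    using g unfolding ft_def y_def B_def \<nu>_def by blast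
qed

section \<open>Existence of good sampling points\<close>

text \<open>
  Rewrites the constants of the two sampling theorems in the form of the final error bound.
\<close>
lemma stability_factor:
  fixes m n :: nat
  assumes "n > m"
  defines "A \<equiv> 1 / (1 - sqrt (real m / real n))"
  shows "A > 0" and "A\<^sup>2 * (sqrt n - sqrt m)\<^sup>2 = n"
proof -
  have n: "real n > 0" "sqrt n > 0" using assms by simp_all
  have gap: "sqrt n - sqrt m > 0" using assms by simp
  have A: "A = sqrt n / (sqrt n - sqrt m)"
    using n gap by (simp add: A_def real_sqrt_divide field_simps)
  show "A > 0" unfolding A using n(2) gap by (rule divide_pos_pos)
  show "A\<^sup>2 * (sqrt n - sqrt m)\<^sup>2 = n" unfolding A using gap by (simp add: power_divide)
qed

lemma sum_append_points:
  fixes F :: "'b \<Rightarrow> real" and n :: nat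
  shows "(\<Sum>i=1..2*n. F (if i \<le> n then x1 i else x2 (i - n))) =
    (\<Sum>i=1..n. F (x1 i)) + (\<Sum>i=1..n. F (x2 i))"
proof -
  have "(\<Sum>i=1..2*n. F (if i \<le> n then x1 i else x2 (i - n))) =
      (\<Sum>i=1..n. F (if i \<le> n then x1 i else x2 (i - n))) + (\<Sum>i=n+1..n+n. F (if i \<le> n then x1 i else x2 (i - n)))"
    using sum.ub_add_nat[of 1 n "\<lambda>i. F (if i \<le> n then x1 i else x2 (i - n))" n] by (simp add: mult_2)
  also have "(\<Sum>i=n+1..n+n. F (if i \<le> n then x1 i else x2 (i - n))) = (\<Sum>i=1..n. F (x2 i))"
    using sum.shift_bounds_cl_nat_ivl[of "\<lambda>i. F (if i \<le> n then x1 i else x2 (i - n))" 1 n n]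
    by (simp add: add.commute)
  finally show ?thesis by simp
qed

theorem corollary16:
  fixes M :: "'a measure" and V :: "('a \<Rightarrow> complex) set" and m :: nat and p :: ennreal
  assumes "prob_space M"
    and "cfun.subspace V" and "cfun.dim V = m" and "m \<ge> 1"
    and "2 \<le> p"
  shows "(V \<subseteq> L2_funs M \<inter> bounded_funs (space M) \<longrightarrow>
           (\<forall>n>m. \<exists>x :: nat \<Rightarrow> 'a. (\<forall>i\<in>{1..2*n}. x i \<in> space M) \<and>
              lsq_error_bound M V p (2*n) x
                (1 + sqrt 2 * (real m powr (1/2 - enn2real (1/p)) / (1 - sqrt (real m / real n))))))
       \<and> (p = 2 \<and> V \<subseteq> L2_funs M \<or> p = \<infinity> \<and> V \<subseteq> bounded_funs (space M) \<longrightarrow>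
           (\<forall>n>m. \<exists>x :: nat \<Rightarrow> 'a. (\<forall>i\<in>{1..n}. x i \<in> space M) \<and>
              lsq_error_bound M V p n x
                (1 + real m powr (1/2 - enn2real (1/p)) / (1 - sqrt (real m / real n)))))"
proof (intro conjI impI allI)
  fix n :: nat
  assume V: "V \<subseteq> L2_funs M \<inter> bounded_funs (space M)" and n: "n > m"
  define B where "B = 1 / (1 - sqrt (real m / real n))"
  have B: "B > 0" "B\<^sup>2 * (sqrt n - sqrt m)\<^sup>2 = n" unfolding B_def by (rule stability_factor[OF n])+
  have VL: "V \<subseteq> L2_funs M" and VB: "V \<subseteq> bounded_funs (space M)" using V by auto
  have sup: "V \<subseteq> supported_on (space M)" using VB by (auto simp: bounded_funs_def supported_on_def)
  obtain x1 where x1: "\<And>i. i \<in> {1..n} \<Longrightarrow> x1 i \<in> space M"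
    and L2: "\<And>g. g \<in> V \<Longrightarrow> (sqrt n - sqrt m)\<^sup>2 * (\<integral>y. (cmod (g y))\<^sup>2 \<partial>M) \<le> (\<Sum>i=1..n. (cmod (g (x1 i)))\<^sup>2)"
    and inj: "\<forall>g\<in>V. (\<forall>i\<in>{1..n}. g (x1 i) = 0) \<longrightarrow> g = 0"
    using L2_sampling[OF assms(1,2) VL assms(3,4) n] by blast
  obtain x2 where x2: "\<And>i. i \<in> {1..n} \<Longrightarrow> x2 i \<in> space M"
    and unif: "\<And>g y. g \<in> V \<Longrightarrow> y \<in> space M \<Longrightarrow>
      (sqrt n - sqrt m)\<^sup>2 * (cmod (g y))\<^sup>2 \<le> m * (\<Sum>i=1..n. (cmod (g (x2 i)))\<^sup>2)"
    using uniform_sampling[OF assms(2) VB assms(3,4) n] by blast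
  define x where "x = (\<lambda>i. if i \<le> n then x1 i else x2 (i - n))"
  have x: "x i \<in> space M" if "i \<in> {1..2*n}" for i
  proof (cases "i \<le> n")
    case True
    then show ?thesis using x1[of i] that by (simp add: x_def)
  next
    case False
    then have "i - n \<in> {1..n}" using that by auto
    then show ?thesis using x2[of "i - n"] False by (simp add: x_def)
  qed
  have split: "(\<Sum>i=1..2*n. (cmod (g (x i)))\<^sup>2) = (\<Sum>i=1..n. (cmod (g (x1 i)))\<^sup>2) + (\<Sum>i=1..n. (cmod (g (x2 i)))\<^sup>2)" for g
    unfolding x_def by (rule sum_append_points)
  have part: "(\<Sum>i=1..n. (cmod (g (x1 i)))\<^sup>2) \<le> (\<Sum>i=1..2*n. (cmod (g (x i)))\<^sup>2)"
    "(\<Sum>i=1..n. (cmod (g (x2 i)))\<^sup>2) \<le> (\<Sum>i=1..2*n. (cmod (g (x i)))\<^sup>2)" for g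
    unfolding split by (simp_all add: sum_nonneg)
  define A where "A = sqrt 2 * B"
  have A2: "A\<^sup>2 = 2 * B\<^sup>2" by (simp add: A_def power_mult_distrib)
  have N: "real (2 * n) = A\<^sup>2 * (sqrt n - sqrt m)\<^sup>2" unfolding A2 using B(2) by simp
  have "lsq_error_bound M V p (2*n) x (1 + A * m powr (1/2 - enn2real (1/p)))"
  proof (rule lsq_error_bound_from_stability[OF assms(1,5,2) sup assms(3,4) _ x])
    show "1 \<le> 2 * n" using n by simp
    show "0 \<le> A" using B(1) by (simp add: A_def)
    show "\<forall>g\<in>V. (\<forall>i\<in>{1..2*n}. g (x i) = 0) \<longrightarrow> g = 0"
    proof (intro ballI impI)
      fix g assume g: "g \<in> V" "\<forall>i\<in>{1..2*n}. g (x i) = 0"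
      have "g (x1 i) = 0" if "i \<in> {1..n}" for i using g(2)[rule_format, of i] that by (simp add: x_def)
      then show "g = 0" using inj g(1) by blast
    qed
    fix g assume g: "g \<in> V"
    show "g \<in> L2_funs M \<and> real (2*n) * (\<integral>y. (cmod (g y))\<^sup>2 \<partial>M) \<le> A\<^sup>2 * (\<Sum>i=1..2*n. (cmod (g (x i)))\<^sup>2)"
    proof
      show "g \<in> L2_funs M" using g VL by blast
      show "real (2*n) * (\<integral>y. (cmod (g y))\<^sup>2 \<partial>M) \<le> A\<^sup>2 * (\<Sum>i=1..2*n. (cmod (g (x i)))\<^sup>2)"
        unfolding N mult.assoc using order_trans[OF L2[OF g] part(1)] by (intro mult_left_mono) auto
    qed
    fix y assume y: "y \<in> space M"
    have "(sqrt n - sqrt m)\<^sup>2 * (cmod (g y))\<^sup>2 \<le> m * (\<Sum>i=1..2*n. (cmod (g (x i)))\<^sup>2)"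
      using unif[OF g y] mult_left_mono[OF part(2), of m g] by simp
    then have "A\<^sup>2 * ((sqrt n - sqrt m)\<^sup>2 * (cmod (g y))\<^sup>2) \<le> A\<^sup>2 * (m * (\<Sum>i=1..2*n. (cmod (g (x i)))\<^sup>2))"
      by (intro mult_left_mono) auto
    then show "real (2*n) * (cmod (g y))\<^sup>2 \<le> m * A\<^sup>2 * (\<Sum>i=1..2*n. (cmod (g (x i)))\<^sup>2)"
      unfolding N by (simp only: mult_ac)
  qed
  also have "1 + A * m powr (1/2 - enn2real (1/p)) =
      1 + sqrt 2 * (real m powr (1/2 - enn2real (1/p)) / (1 - sqrt (real m / real n)))"
    by (simp add: A_def B_def)
  finally show "\<exists>x :: nat \<Rightarrow> 'a. (\<forall>i\<in>{1..2*n}. x i \<in> space M) \<and>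
      lsq_error_bound M V p (2*n) x
        (1 + sqrt 2 * (real m powr (1/2 - enn2real (1/p)) / (1 - sqrt (real m / real n))))"
    using x by blast
next
  fix n :: nat
  assume V: "p = 2 \<and> V \<subseteq> L2_funs M \<or> p = \<infinity> \<and> V \<subseteq> bounded_funs (space M)" and n: "n > m"
  define A where "A = 1 / (1 - sqrt (real m / real n))"
  have A: "A > 0" "A\<^sup>2 * (sqrt n - sqrt m)\<^sup>2 = n" unfolding A_def by (rule stability_factor[OF n])+
  have sup: "V \<subseteq> supported_on (space M)"
    using V by (auto simp: bounded_funs_def L2_funs_def supported_on_def)
  have N: "1 \<le> n" using n by simp
  have A_mult: "n * r = A\<^sup>2 * ((sqrt n - sqrt m)\<^sup>2 * r)" for r :: real
    unfolding mult.assoc[symmetric] A(2) ..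
  have "\<exists>x. (\<forall>i\<in>{1..n}. x i \<in> space M) \<and> lsq_error_bound M V p n x (1 + A * m powr (1/2 - enn2real (1/p)))"
    using V
  proof (elim disjE conjE)
    assume p: "p = 2" and VL: "V \<subseteq> L2_funs M"
    obtain x where x: "\<And>i. i \<in> {1..n} \<Longrightarrow> x i \<in> space M"
      and L2: "\<And>g. g \<in> V \<Longrightarrow> (sqrt n - sqrt m)\<^sup>2 * (\<integral>y. (cmod (g y))\<^sup>2 \<partial>M) \<le> (\<Sum>i=1..n. (cmod (g (x i)))\<^sup>2)"
      and inj: "\<forall>g\<in>V. (\<forall>i\<in>{1..n}. g (x i) = 0) \<longrightarrow> g = 0"
      using L2_sampling[OF assms(1,2) VL assms(3,4) n] by blast
    have "lsq_error_bound M V p n x (1 + A * m powr (1/2 - enn2real (1/p)))"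
    proof (rule lsq_error_bound_from_stability[OF assms(1,5,2) sup assms(3,4) N x less_imp_le[OF A(1)] inj])
      fix g assume g: "g \<in> V"
      show "g \<in> L2_funs M \<and> n * (\<integral>y. (cmod (g y))\<^sup>2 \<partial>M) \<le> A\<^sup>2 * (\<Sum>i=1..n. (cmod (g (x i)))\<^sup>2)"
      proof
        show "g \<in> L2_funs M" using g VL by blast
        show "n * (\<integral>y. (cmod (g y))\<^sup>2 \<partial>M) \<le> A\<^sup>2 * (\<Sum>i=1..n. (cmod (g (x i)))\<^sup>2)"
          by (subst A_mult) (use L2[OF g] in \<open>auto intro: mult_left_mono\<close>)
      qed
    qed (use p in auto)
    then show ?thesis using x by blast
  next
    assume p: "p = \<infinity>" and VB: "V \<subseteq> bounded_funs (space M)"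
    obtain x where x: "\<And>i. i \<in> {1..n} \<Longrightarrow> x i \<in> space M"
      and unif: "\<And>g y. g \<in> V \<Longrightarrow> y \<in> space M \<Longrightarrow>
        (sqrt n - sqrt m)\<^sup>2 * (cmod (g y))\<^sup>2 \<le> m * (\<Sum>i=1..n. (cmod (g (x i)))\<^sup>2)"
      using uniform_sampling[OF assms(2) VB assms(3,4) n] by blast
    have inj: "\<forall>g\<in>V. (\<forall>i\<in>{1..n}. g (x i) = 0) \<longrightarrow> g = 0"
    proof (intro ballI impI)
      fix g assume g: "g \<in> V" "\<forall>i\<in>{1..n}. g (x i) = 0"
      have zero: "(\<Sum>i=1..n. (cmod (g (x i)))\<^sup>2) = 0" using g(2) by (intro sum.neutral) auto
      have "g y = 0" for y
      proof (cases "y \<in> space M")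
        case True
        have "(sqrt n - sqrt m)\<^sup>2 * (cmod (g y))\<^sup>2 \<le> 0" using unif[OF g(1) True] zero by simp
        moreover have "(sqrt n - sqrt m)\<^sup>2 > 0" using n by simp
        ultimately have "(cmod (g y))\<^sup>2 \<le> 0" by (simp add: mult_le_0_iff)
        then show ?thesis by simp
      next
        case False
        then show ?thesis using supported_onD[OF sup g(1)] by blast
      qed
      then show "g = 0" by (intro ext) simp
    qed
    have "lsq_error_bound M V p n x (1 + A * m powr (1/2 - enn2real (1/p)))"
    proof (rule lsq_error_bound_from_stability[OF assms(1,5,2) sup assms(3,4) N x less_imp_le[OF A(1)] inj])
      fix g y assume g: "g \<in> V" and y: "y \<in> space M"
      have "A\<^sup>2 * ((sqrt n - sqrt m)\<^sup>2 * (cmod (g y))\<^sup>2) \<le> A\<^sup>2 * (m * (\<Sum>i=1..n. (cmod (g (x i)))\<^sup>2))"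
        using unif[OF g y] by (intro mult_left_mono) auto
      then show "n * (cmod (g y))\<^sup>2 \<le> m * A\<^sup>2 * (\<Sum>i=1..n. (cmod (g (x i)))\<^sup>2)"
        by (subst A_mult) (simp only: mult_ac)
    qed (use p in auto)
    then show ?thesis using x by blast
  qed
  also have "1 + A * m powr (1/2 - enn2real (1/p)) =
      1 + real m powr (1/2 - enn2real (1/p)) / (1 - sqrt (real m / real n))"
    by (simp add: A_def)
  finally show "\<exists>x :: nat \<Rightarrow> 'a. (\<forall>i\<in>{1..n}. x i \<in> space M) \<and>
      lsq_error_bound M V p n x
        (1 + real m powr (1/2 - enn2real (1/p)) / (1 - sqrt (real m / real n)))" .
qed

end
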